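(* Let $\mathcal{A}$ be a complex, unital, semisimple Banach algebra and let $\mathcal{B}$ be a complex, unital Banach algebra having a separating family of finite-dimensional irreducible representations. Let $T:\mathcal{A}\rightarrow\mathcal{B}$ be a linear, unital (i.e. $T(1)=1$) and surjective map such that $\rho(T(a))=\rho(a)$ for all $a\in\mathcal{A}$, where $\rho$ denotes the spectral radius. Then $T$ is a Jordan morphism, that is, $T(a^{2})=T(a)^{2}$ for all $a\in\mathcal{A}$.
   Context: For an element $a$ of a complex unital Banach algebra, $\sigma(a)$ denotes its spectrum and $\rho(a)$ its spectral radius. A Banach algebra is semisimple if its Jacobson radical is $\{0\}$. A finite-dimensional irreducible representation of $\mathcal{B}$ is an algebra homomorphism $\pi$ from $\mathcal{B}$ into the algebra of linear operators on a nonzero finite-dimensional complex vector space $X$ such that $\pi(\mathcal{B})\neq\{0\}$ and the only $\pi(\mathcal{B})$-invariant subspaces of $X$ are $\{0\}$ and $X$. The algebra $\mathcal{B}$ has a separating family of finite-dimensional irreducible representations if for every nonzero $b\in\mathcal{B}$ there is a finite-dimensional irreducible representation $\pi$ of $\mathcal{B}$ with $\pi(b)\neq 0$. $T$ is not assumed to be continuous or injective. *)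

theory Defs
  imports Complex_Main
begin

class complex_vector = ab_group_add +
  fixes scaleC :: "complex \<Rightarrow> 'a \<Rightarrow> 'a"  (infixr \<open>*\<^sub>C\<close> 75)
  assumes scaleC_add_right: "c *\<^sub>C (x + y) = c *\<^sub>C x + c *\<^sub>C y"
    and scaleC_add_left: "(c + d) *\<^sub>C x = c *\<^sub>C x + d *\<^sub>C x"
    and scaleC_scaleC: "c *\<^sub>C (d *\<^sub>C x) = (c * d) *\<^sub>C x"
    and scaleC_one: "1 *\<^sub>C x = x"

global_interpretation complex_vector: vector_space "scaleC :: complex \<Rightarrow> 'a \<Rightarrow> 'a::complex_vector"
  by unfold_locales (simp_all add: scaleC_add_right scaleC_add_left scaleC_scaleC scaleC_one)

class complex_algebra_1 = complex_vector + ring_1 +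
  assumes mult_scaleC_left: "(c *\<^sub>C x) * y = c *\<^sub>C (x * y)"
    and mult_scaleC_right: "x * (c *\<^sub>C y) = c *\<^sub>C (x * y)"

text \<open>Complex unital Banach algebras, normalised by \<open>norm 1 = 1\<close> (an axiom of
  \<^class>\<open>real_normed_algebra_1\<close>).\<close>

class complex_banach_algebra_1 = complex_algebra_1 + real_normed_algebra_1 + banach +
  assumes scaleR_scaleC: "r *\<^sub>R x = complex_of_real r *\<^sub>C x"
    and norm_scaleC: "norm (c *\<^sub>C x) = cmod c * norm x"

definition alg_invertible :: "'a::ring_1 \<Rightarrow> bool" where
  "alg_invertible a \<longleftrightarrow> (\<exists>b. a * b = 1 \<and> b * a = 1)"

definition alg_spectrum :: "'a::complex_algebra_1 \<Rightarrow> complex set" where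
  "alg_spectrum a = {z. \<not> alg_invertible (z *\<^sub>C 1 - a)}"

text \<open>In a Banach algebra the spectrum is nonempty and bounded, so this real supremum is never
  the unspecified value of \<^const>\<open>Sup\<close>.\<close>

definition alg_spectral_radius :: "'a::complex_banach_algebra_1 \<Rightarrow> real" where
  "alg_spectral_radius a = (SUP z\<in>alg_spectrum a. cmod z)"

text \<open>Since the ring is unital, a left ideal of a complex algebra is automatically a complex
  subspace.\<close>

definition left_ideal :: "'a::ring_1 set \<Rightarrow> bool" where
  "left_ideal I \<longleftrightarrow> 0 \<in> I \<and> (\<forall>x\<in>I. \<forall>y\<in>I. x + y \<in> I) \<and> (\<forall>a. \<forall>x\<in>I. a * x \<in> I)"

definition maximal_left_ideal :: "'a::ring_1 set \<Rightarrow> bool" where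
  "maximal_left_ideal I \<longleftrightarrow>
     left_ideal I \<and> I \<noteq> UNIV \<and> (\<forall>J. left_ideal J \<longrightarrow> I \<subseteq> J \<longrightarrow> J = I \<or> J = UNIV)"

definition jacobson_radical :: "'a::ring_1 set" where
  "jacobson_radical = \<Inter> {I. maximal_left_ideal I}"

text \<open>The representation space is a complex subspace \<open>X\<close> of an ambient vector space, so that
  its dimension need not be fixed by a type. The map \<open>\<pi> b\<close> stands for the operator it induces on
  \<open>X\<close>; its values outside \<open>X\<close> are irrelevant. The homomorphism is not required to be unital.\<close>

definition representation_on :: "'x::complex_vector set \<Rightarrow> ('b::complex_algebra_1 \<Rightarrow> 'x \<Rightarrow> 'x) \<Rightarrow> bool"
  where
  "representation_on X \<pi> \<longleftrightarrow>
     complex_vector.subspace X \<and>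
     (\<forall>b. \<forall>x\<in>X. \<pi> b x \<in> X) \<and>
     (\<forall>b. \<forall>x\<in>X. \<forall>y\<in>X. \<pi> b (x + y) = \<pi> b x + \<pi> b y) \<and>
     (\<forall>b c. \<forall>x\<in>X. \<pi> b (c *\<^sub>C x) = c *\<^sub>C \<pi> b x) \<and>
     (\<forall>a b. \<forall>x\<in>X. \<pi> (a + b) x = \<pi> a x + \<pi> b x) \<and>
     (\<forall>b c. \<forall>x\<in>X. \<pi> (c *\<^sub>C b) x = c *\<^sub>C \<pi> b x) \<and>
     (\<forall>a b. \<forall>x\<in>X. \<pi> (a * b) x = \<pi> a (\<pi> b x))"

definition nonzero_on :: "'x::zero set \<Rightarrow> ('x \<Rightarrow> 'x) \<Rightarrow> bool" where
  "nonzero_on X f \<longleftrightarrow> (\<exists>x\<in>X. f x \<noteq> 0)"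

definition fd_irreducible_rep :: "'x::complex_vector set \<Rightarrow> ('b::complex_algebra_1 \<Rightarrow> 'x \<Rightarrow> 'x) \<Rightarrow> bool"
  where
  "fd_irreducible_rep X \<pi> \<longleftrightarrow>
     representation_on X \<pi> \<and>
     X \<noteq> {0} \<and>
     (\<exists>S. finite S \<and> X = complex_vector.span S) \<and>
     (\<exists>b. nonzero_on X (\<pi> b)) \<and>
     (\<forall>Y. complex_vector.subspace Y \<and> Y \<subseteq> X \<and> (\<forall>b. \<forall>y\<in>Y. \<pi> b y \<in> Y) \<longrightarrow> Y = {0} \<or> Y = X)"

text \<open>All representation spaces are taken inside one ambient complex vector space \<open>'x\<close>. This is
  no restriction when \<open>'x\<close> is left arbitrary: any family of vector spaces embeds into its direct
  sum.\<close>

definition separating_fd_irreducible_reps ::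
    "'x::complex_vector itself \<Rightarrow> 'b::complex_algebra_1 itself \<Rightarrow> bool" where
  "separating_fd_irreducible_reps _ _ \<longleftrightarrow>
     (\<forall>b::'b. b \<noteq> 0 \<longrightarrow>
        (\<exists>(X::'x set) (\<pi>::'b \<Rightarrow> 'x \<Rightarrow> 'x). fd_irreducible_rep X \<pi> \<and> nonzero_on X (\<pi> b)))"

end

theory Submission
  imports Defs "HOL-Complex_Analysis.Cauchy_Integral_Formula" "Jordan_Normal_Form.Schur_Decomposition"
begin

text \<open>Let \<open>t\<close> be the trace of a finite-dimensional irreducible representation \<open>\<pi>\<close> of \<open>B\<close> and put
  \<open>d(a) = T(a\<^sup>2) - T(a)\<^sup>2\<close>. Since \<open>\<bar>t b\<bar>\<close> is at most the degree of \<open>\<pi>\<close> times the spectral radius of \<open>b\<close>,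
  Cauchy estimates for \<open>t\<close> apply to curves of bounded spectral radius.

  Conjugating \<open>y\<close> by approximations of \<open>exp (z x)\<close> yields \<open>t(T(x y)) = t(T(y x))\<close>. For the rest,
  follow H. Cartan's uniqueness theorem: conjugating \<open>T\<close> with a Moebius transformation gives a
  map of the spectral unit ball of \<open>B\<close> of the form \<open>x + w d + O(x\<^sup>3)\<close>, whose iterates have
  quadratic part \<open>n w d\<close>. They remain in the spectral unit ball, so \<open>t(d(a)) = 0\<close> and
  \<open>t(T(a) d(a)) = 0\<close>. To work with polynomials only, the Moebius transformations are replaced by
  quadratic polynomials, which preserve the disc up to \<open>O(w\<^sup>2)\<close>, and \<open>w\<^sup>-\<^sup>2\<close> iterates are taken.

  Polarising these identities gives \<open>t(T(c) d(a)) = 0\<close> for all \<open>c\<close>. If \<open>\<pi>(d(a)) \<noteq> 0\<close>, then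
  irreducibility provides an element \<open>c d(a)\<close> whose image has eigenvalue \<open>1\<close>, although the
  traces of all its powers vanish, which is impossible.\<close>

section \<open>Spectra\<close>

lemma scaleC_mult_scaleC: "c *\<^sub>C (x::'a::complex_algebra_1) * (d *\<^sub>C y) = (c * d) *\<^sub>C (x * y)"
  by (simp add: mult_scaleC_left mult_scaleC_right scaleC_scaleC)

lemma alg_invertible_mult: "alg_invertible a \<Longrightarrow> alg_invertible b \<Longrightarrow> alg_invertible (a * b)"
  unfolding alg_invertible_def
proof (elim exE conjE)
  fix c d assume h: "a * c = 1" "c * a = 1" "b * d = 1" "d * b = 1"
  have "a * b * (d * c) = 1"
    by (metis h(1) h(3) mult.assoc mult.right_neutral)
  moreover have "d * c * (a * b) = 1"
    by (metis h(2) h(4) mult.assoc mult.right_neutral)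
  ultimately show "\<exists>e. a * b * e = 1 \<and> e * (a * b) = 1" by blast
qed

lemma alg_invertible_scaleC:
  fixes a :: "'a::complex_algebra_1"
  assumes "c \<noteq> 0" "alg_invertible a"
  shows "alg_invertible (c *\<^sub>C a)"
proof -
  obtain b where "a * b = 1" "b * a = 1"
    using assms(2) unfolding alg_invertible_def by blast
  then have "c *\<^sub>C a * (inverse c *\<^sub>C b) = 1" "inverse c *\<^sub>C b * (c *\<^sub>C a) = 1"
    using assms(1) by (simp_all add: scaleC_mult_scaleC scaleC_one)
  then show ?thesis unfolding alg_invertible_def by blast
qed

text \<open>The inverse is the Neumann series; both products telescope.\<close>

lemma alg_invertible_one_minus:
  fixes x :: "'a::{real_normed_algebra_1,banach}"
  assumes "norm x < 1"
  shows "alg_invertible (1 - x)"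
proof -
  have s: "summable (\<lambda>n. x ^ n)"
    using assms by (rule complete_algebra_summable_geometric)
  have "(\<lambda>n. x ^ n - x ^ Suc n) sums (x ^ 0 - 0)"
    by (rule telescope_sums'[OF LIMSEQ_power_zero[OF assms]])
  then have t: "(\<lambda>n. x ^ n - x ^ Suc n) sums 1" by simp
  have "(\<lambda>n. (1 - x) * x ^ n) sums ((1 - x) * (\<Sum>n. x ^ n))"
    by (rule sums_mult[OF summable_sums[OF s]])
  moreover have "(\<lambda>n. (1 - x) * x ^ n) = (\<lambda>n. x ^ n - x ^ Suc n)"
    by (simp add: left_diff_distrib)
  ultimately have 1: "(1 - x) * (\<Sum>n. x ^ n) = 1"
    using t sums_unique2 by metis
  have "(\<lambda>n. x ^ n * (1 - x)) sums ((\<Sum>n. x ^ n) * (1 - x))"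
    by (rule sums_mult2[OF summable_sums[OF s]])
  moreover have "(\<lambda>n. x ^ n * (1 - x)) = (\<lambda>n. x ^ n - x ^ Suc n)"
    by (simp add: right_diff_distrib power_commutes)
  ultimately have 2: "(\<Sum>n. x ^ n) * (1 - x) = 1"
    using t sums_unique2 by metis
  show ?thesis unfolding alg_invertible_def using 1 2 by blast
qed

lemma norm_alg_spectrum:
  fixes a :: "'a::complex_banach_algebra_1"
  assumes "z \<in> alg_spectrum a"
  shows "cmod z \<le> norm a"
proof (rule ccontr)
  assume "\<not> cmod z \<le> norm a"
  then have z: "norm a < cmod z" "z \<noteq> 0" by auto
  have "norm (inverse z *\<^sub>C a) = norm a / cmod z"
    by (simp add: norm_scaleC norm_inverse divide_inverse mult.commute)
  then have "norm (inverse z *\<^sub>C a) < 1"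
    using z by simp
  then have "alg_invertible (z *\<^sub>C (1 - inverse z *\<^sub>C a))"
    using z(2) by (intro alg_invertible_scaleC alg_invertible_one_minus)
  moreover have "z *\<^sub>C (1 - inverse z *\<^sub>C a) = z *\<^sub>C 1 - a"
    using z(2) by (simp add: complex_vector.scale_right_diff_distrib scaleC_scaleC scaleC_one)
  ultimately show False using assms by (simp add: alg_spectrum_def)
qed

lemma alg_spectrum_le_radius:
  "z \<in> alg_spectrum (a::'a::complex_banach_algebra_1) \<Longrightarrow> cmod z \<le> alg_spectral_radius a"
  unfolding alg_spectral_radius_def
  by (rule cSUP_upper) (auto intro!: bdd_aboveI2 norm_alg_spectrum)

text \<open>\<open>Sup {}\<close> is an unspecified real, so nonemptiness has to be supplied. Below
  it is carried along as the hypothesis \<open>ne\<close>; in the end it comes from a representation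
  of the target algebra, which takes the place of Gelfand's theorem.\<close>

lemma alg_spectral_radius_le:
  "alg_spectrum a \<noteq> {} \<Longrightarrow> (\<And>z. z \<in> alg_spectrum a \<Longrightarrow> cmod z \<le> R) \<Longrightarrow> alg_spectral_radius a \<le> R"
  unfolding alg_spectral_radius_def by (rule cSUP_least)

lemma alg_spectral_radius_le_norm:
  "alg_spectrum a \<noteq> {} \<Longrightarrow> alg_spectral_radius a \<le> norm a"
  by (rule alg_spectral_radius_le) (auto intro: norm_alg_spectrum)

lemma alg_spectrum_affine:
  fixes a :: "'a::complex_algebra_1"
  assumes "z \<in> alg_spectrum (\<alpha> *\<^sub>C 1 + \<beta> *\<^sub>C a)" "\<beta> \<noteq> 0"
  shows "\<exists>\<mu>\<in>alg_spectrum a. z = \<alpha> + \<beta> * \<mu>"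
proof -
  define \<mu> where "\<mu> = (z - \<alpha>) / \<beta>"
  have z: "z = \<alpha> + \<beta> * \<mu>" using assms(2) by (simp add: \<mu>_def)
  have "z *\<^sub>C 1 - (\<alpha> *\<^sub>C 1 + \<beta> *\<^sub>C a) = \<beta> *\<^sub>C (\<mu> *\<^sub>C 1 - a)"
    by (simp add: z complex_vector.scale_left_distrib complex_vector.scale_right_diff_distrib
        scaleC_scaleC)
  then have "\<mu> \<in> alg_spectrum a"
    using assms alg_invertible_scaleC[of \<beta> "\<mu> *\<^sub>C 1 - a"] by (auto simp: alg_spectrum_def)
  with z show ?thesis by blast
qed

lemma quadratic_factorization:
  fixes \<alpha> \<beta> \<gamma> :: complex
  assumes "\<gamma> \<noteq> 0"
  obtains \<mu> \<nu> where "\<beta> = - \<gamma> * (\<mu> + \<nu>)" "\<alpha> = \<gamma> * \<mu> * \<nu>"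
proof
  define s where "s = csqrt (\<beta>^2 - 4 * \<gamma> * \<alpha>)"
  have s: "s * s = \<beta> * \<beta> - 4 * \<gamma> * \<alpha>"
    using power2_csqrt[of "\<beta>^2 - 4 * \<gamma> * \<alpha>"] by (simp add: s_def power2_eq_square)
  show "\<beta> = - \<gamma> * ((- \<beta> + s) / (2 * \<gamma>) + (- \<beta> - s) / (2 * \<gamma>))"
    using assms by (simp add: field_simps)
  have "\<gamma> * ((- \<beta> + s) / (2 * \<gamma>)) * ((- \<beta> - s) / (2 * \<gamma>)) = (\<beta> * \<beta> - s * s) / (4 * \<gamma>)"
    using assms by (simp add: field_simps)
  also have "\<dots> = \<alpha>" using assms by (simp add: s)
  finally show "\<alpha> = \<gamma> * ((- \<beta> + s) / (2 * \<gamma>)) * ((- \<beta> - s) / (2 * \<gamma>))" by simp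
qed

text \<open>Write \<open>q\<close> for the quadratic polynomial. Then \<open>z - q\<close> splits
  into two linear factors, and at both roots \<open>q\<close> takes the value \<open>z\<close>. If
  \<open>z - q(a)\<close> is not invertible, one of the corresponding factors in \<open>a\<close> is
  not invertible either.\<close>

lemma alg_spectrum_quadratic:
  fixes a :: "'a::complex_algebra_1"
  assumes z: "z \<in> alg_spectrum (\<alpha> *\<^sub>C 1 + \<beta> *\<^sub>C a + \<gamma> *\<^sub>C (a * a))" and "\<gamma> \<noteq> 0"
  shows "\<exists>\<mu>\<in>alg_spectrum a. z = \<alpha> + \<beta> * \<mu> + \<gamma> * \<mu>^2"
proof -
  obtain \<mu> \<nu> where mn: "\<beta> = - \<gamma> * (\<mu> + \<nu>)" "\<alpha> - z = \<gamma> * \<mu> * \<nu>"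
    using quadratic_factorization[OF \<open>\<gamma> \<noteq> 0\<close>, of \<beta> "\<alpha> - z"] by metis
  have "(\<mu> *\<^sub>C 1 - a) * (\<nu> *\<^sub>C 1 - a) = (\<mu> * \<nu>) *\<^sub>C 1 - (\<mu> + \<nu>) *\<^sub>C a + a * a"
    by (simp add: left_diff_distrib right_diff_distrib mult_scaleC_left mult_scaleC_right
        scaleC_scaleC complex_vector.scale_left_distrib complex_vector.scale_right_diff_distrib)
  then have "(- \<gamma>) *\<^sub>C ((\<mu> *\<^sub>C 1 - a) * (\<nu> *\<^sub>C 1 - a)) =
      (- \<gamma> * \<mu> * \<nu>) *\<^sub>C 1 + (\<gamma> * (\<mu> + \<nu>)) *\<^sub>C a - \<gamma> *\<^sub>C (a * a)"
    by (simp add: scaleC_add_right complex_vector.scale_right_diff_distrib scaleC_scaleC mult.assoc)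
  also have "\<dots> = z *\<^sub>C 1 - (\<alpha> *\<^sub>C 1 + \<beta> *\<^sub>C a + \<gamma> *\<^sub>C (a * a))"
  proof -
    have "- \<gamma> * \<mu> * \<nu> = z - \<alpha>" using mn(2) by (metis minus_diff_eq mult_minus_left)
    moreover have "\<gamma> * (\<mu> + \<nu>) = - \<beta>" by (simp add: mn(1))
    ultimately show ?thesis by (simp add: complex_vector.scale_left_diff_distrib)
  qed
  finally have "\<not> alg_invertible ((- \<gamma>) *\<^sub>C ((\<mu> *\<^sub>C 1 - a) * (\<nu> *\<^sub>C 1 - a)))"
    using z by (simp add: alg_spectrum_def)
  then have "\<not> alg_invertible (\<mu> *\<^sub>C 1 - a) \<or> \<not> alg_invertible (\<nu> *\<^sub>C 1 - a)"
    using alg_invertible_scaleC alg_invertible_mult \<open>\<gamma> \<noteq> 0\<close> neg_equal_0_iff_equal by metis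
  moreover have "z = \<alpha> + \<beta> * \<mu> + \<gamma> * \<mu>^2" "z = \<alpha> + \<beta> * \<nu> + \<gamma> * \<nu>^2"
  proof -
    have "z = \<alpha> - \<gamma> * \<mu> * \<nu>" by (simp add: mn(2)[symmetric])
    moreover have "\<alpha> + \<beta> * \<mu> + \<gamma> * \<mu>^2 = \<alpha> - \<gamma> * \<mu> * \<nu>"
      "\<alpha> + \<beta> * \<nu> + \<gamma> * \<nu>^2 = \<alpha> - \<gamma> * \<mu> * \<nu>"
      unfolding mn(1) by (simp_all add: algebra_simps power2_eq_square)
    ultimately show "z = \<alpha> + \<beta> * \<mu> + \<gamma> * \<mu>^2" "z = \<alpha> + \<beta> * \<nu> + \<gamma> * \<nu>^2"
      by simp_all
  qed
  ultimately show ?thesis unfolding alg_spectrum_def by blast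
qed

lemma alg_spectral_radius_quadratic_le:
  fixes a :: "'a::complex_banach_algebra_1"
  assumes ne: "\<And>x::'a. alg_spectrum x \<noteq> {}" and "\<gamma> \<noteq> 0" and "alg_spectral_radius a \<le> r"
    and "\<And>\<mu>. cmod \<mu> \<le> r \<Longrightarrow> cmod (\<alpha> + \<beta> * \<mu> + \<gamma> * \<mu>^2) \<le> R"
  shows "alg_spectral_radius (\<alpha> *\<^sub>C 1 + \<beta> *\<^sub>C a + \<gamma> *\<^sub>C (a * a)) \<le> R"
proof (rule alg_spectral_radius_le[OF ne])
  fix z assume "z \<in> alg_spectrum (\<alpha> *\<^sub>C 1 + \<beta> *\<^sub>C a + \<gamma> *\<^sub>C (a * a))"
  from alg_spectrum_quadratic[OF this \<open>\<gamma> \<noteq> 0\<close>] show "cmod z \<le> R"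
    using assms(3,4) alg_spectrum_le_radius by (metis order_trans)
qed

lemma alg_spectral_radius_scaleC_le:
  fixes a :: "'a::complex_banach_algebra_1"
  assumes ne: "\<And>x::'a. alg_spectrum x \<noteq> {}"
  shows "alg_spectral_radius (c *\<^sub>C a) \<le> cmod c * alg_spectral_radius a"
proof (cases "c = 0")
  case True
  then show ?thesis using alg_spectral_radius_le_norm[OF ne, of 0] by simp
next
  case False
  show ?thesis
  proof (rule alg_spectral_radius_le[OF ne])
    fix z assume "z \<in> alg_spectrum (c *\<^sub>C a)"
    then obtain \<mu> where "\<mu> \<in> alg_spectrum a" "z = c * \<mu>"
      using alg_spectrum_affine[of z 0 c a] False by auto
    then show "cmod z \<le> cmod c * alg_spectral_radius a"
      by (simp add: norm_mult mult_left_mono alg_spectrum_le_radius)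
  qed
qed

lemma alg_spectral_radius_square_le:
  fixes a :: "'a::complex_banach_algebra_1"
  assumes ne: "\<And>x::'a. alg_spectrum x \<noteq> {}"
  shows "alg_spectral_radius (a * a) \<le> (alg_spectral_radius a)^2"
proof -
  have "alg_spectral_radius (0 *\<^sub>C 1 + 0 *\<^sub>C a + 1 *\<^sub>C (a * a)) \<le> (alg_spectral_radius a)^2"
    by (rule alg_spectral_radius_quadratic_le[OF ne _ order_refl])
       (auto simp: norm_power intro!: power_mono)
  then show ?thesis by (simp add: scaleC_one)
qed

lemma alg_spectral_radius_nonneg:
  fixes a :: "'a::complex_banach_algebra_1"
  assumes ne: "\<And>x::'a. alg_spectrum x \<noteq> {}"
  shows "0 \<le> alg_spectral_radius a"
  using ne[of a] alg_spectrum_le_radius norm_ge_zero by (metis all_not_in_conv order_trans)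

text \<open>Jacobson's lemma: if \<open>c\<close> inverts \<open>1 - a * b\<close>, then
  \<open>1 + b * c * a\<close> inverts \<open>1 - b * a\<close>.\<close>

lemma alg_invertible_one_minus_commute:
  assumes "alg_invertible (1 - a * b :: 'a::ring_1)"
  shows "alg_invertible (1 - b * a)"
proof -
  obtain c where c: "(1 - a * b) * c = 1" "c * (1 - a * b) = 1"
    using assms unfolding alg_invertible_def by blast
  have 1: "a * b * c = c - 1" "c * (a * b) = c - 1"
    using c by (simp_all add: algebra_simps)
  have "b * a * (b * c * a) = b * (a * b * c) * a" by (simp add: mult.assoc)
  then have 2: "b * a * (b * c * a) = b * c * a - b * a"
    by (simp add: 1 left_diff_distrib right_diff_distrib)
  have "b * c * a * (b * a) = b * (c * (a * b)) * a" by (simp add: mult.assoc)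
  then have 3: "b * c * a * (b * a) = b * c * a - b * a"
    by (simp add: 1 left_diff_distrib right_diff_distrib)
  have "(1 - b * a) * (1 + b * c * a) = 1" "(1 + b * c * a) * (1 - b * a) = 1"
    using 2 3 by (simp_all add: left_diff_distrib right_diff_distrib ring_distribs)
  then show ?thesis unfolding alg_invertible_def by blast
qed

lemma alg_spectrum_mult_commute:
  fixes a b :: "'a::complex_algebra_1"
  assumes "z \<in> alg_spectrum (a * b)" "z \<noteq> 0"
  shows "z \<in> alg_spectrum (b * a)"
proof (rule ccontr)
  have eq: "inverse z *\<^sub>C (z *\<^sub>C 1 - x * y) = 1 - (inverse z *\<^sub>C x) * y" for x y :: 'a
    using assms(2) by (simp add: complex_vector.scale_right_diff_distrib mult_scaleC_left)
  have eq': "z *\<^sub>C (1 - (inverse z *\<^sub>C x) * y) = z *\<^sub>C 1 - x * y" for x y :: 'a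
    using assms(2) by (simp add: complex_vector.scale_right_diff_distrib mult_scaleC_left)
  assume "z \<notin> alg_spectrum (b * a)"
  then have "alg_invertible (z *\<^sub>C 1 - b * a)" by (simp add: alg_spectrum_def)
  then have "alg_invertible (1 - (inverse z *\<^sub>C b) * a)"
    using alg_invertible_scaleC[of "inverse z" "z *\<^sub>C 1 - b * a"] assms(2) by (simp only: eq) simp
  then have "alg_invertible (1 - b * (inverse z *\<^sub>C a))"
    by (simp only: mult_scaleC_left mult_scaleC_right)
  then have "alg_invertible (1 - (inverse z *\<^sub>C a) * b)"
    by (rule alg_invertible_one_minus_commute)
  then have "alg_invertible (z *\<^sub>C 1 - a * b)"
    using alg_invertible_scaleC[of z "1 - (inverse z *\<^sub>C a) * b"] assms(2) by (simp only: eq') simp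
  then show False
    using assms(1) by (simp add: alg_spectrum_def)
qed

text \<open>Both products have the same nonzero spectral values. The reversed order on the right is
  the point: for \<open>(u * y) * v\<close> it brings \<open>v\<close> next to \<open>u\<close>,
  which helps when these nearly cancel.\<close>

lemma alg_spectral_radius_mult_le:
  fixes a b :: "'a::complex_banach_algebra_1"
  assumes ne: "\<And>x::'a. alg_spectrum x \<noteq> {}"
  shows "alg_spectral_radius (a * b) \<le> norm (b * a)"
proof (rule alg_spectral_radius_le[OF ne])
  fix z assume "z \<in> alg_spectrum (a * b)"
  then show "cmod z \<le> norm (b * a)"
    using norm_alg_spectrum[OF alg_spectrum_mult_commute] by (cases "z = 0") auto
qed

section \<open>Traces of complex matrices\<close>

definition mat_trace :: "'a::comm_monoid_add mat \<Rightarrow> 'a" where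
  "mat_trace A = (\<Sum>i<dim_row A. A $$ (i, i))"

lemma mat_trace_mult:
  assumes "A \<in> carrier_mat n m" "B \<in> carrier_mat m n"
  shows "mat_trace (A * B) = (\<Sum>i<n. \<Sum>j<m. A $$ (i, j) * B $$ (j, i))"
  using assms by (auto simp: mat_trace_def scalar_prod_def atLeast0LessThan intro!: sum.cong)

lemma mat_trace_mult_commute:
  fixes A B :: "'a::comm_semiring_1 mat"
  assumes "A \<in> carrier_mat n m" "B \<in> carrier_mat m n"
  shows "mat_trace (A * B) = mat_trace (B * A)"
  unfolding mat_trace_mult[OF assms] mat_trace_mult[OF assms(2,1)]
  by (subst sum.swap) (simp add: mult.commute)

lemma mat_trace_similar:
  assumes "similar_mat_wit A B P Q"
  shows "mat_trace A = mat_trace (B :: 'a::comm_ring_1 mat)"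
proof -
  define n where "n = dim_row A"
  note w = similar_mat_witD[OF n_def assms]
  have "mat_trace A = mat_trace (P * (B * Q))"
    using w by (simp add: assoc_mult_mat[of P n n B n Q n])
  also have "\<dots> = mat_trace ((B * Q) * P)"
    using w by (intro mat_trace_mult_commute[of _ n n]) auto
  also have "\<dots> = mat_trace B"
    using w by (simp add: assoc_mult_mat[of B n n Q n P n])
  finally show ?thesis .
qed

lemma upper_triangular_mult_diag:
  fixes A B :: "'a::comm_ring_1 mat"
  assumes AB: "A \<in> carrier_mat n n" "B \<in> carrier_mat n n"
    and ut: "upper_triangular A" "upper_triangular B"
  shows "upper_triangular (A * B)"
    and "i < n \<Longrightarrow> (A * B) $$ (i, i) = A $$ (i, i) * B $$ (i, i)"
proof -
  have eq: "(A * B) $$ (i, j) = (\<Sum>k<n. A $$ (i, k) * B $$ (k, j))" if "i < n" "j < n" for i j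
    using AB that by (auto simp: scalar_prod_def atLeast0LessThan intro!: sum.cong)
  have z: "A $$ (i, k) * B $$ (k, j) = 0" if "i < n" "k < n" "k < i \<or> j < k" for i j k
    using that AB ut unfolding upper_triangular_def by auto
  show "upper_triangular (A * B)"
    unfolding upper_triangular_def
  proof (intro allI impI)
    fix i j assume "i < dim_row (A * B)" "j < i"
    then have "i < n" "j < n" using AB by auto
    then show "(A * B) $$ (i, j) = 0"
      unfolding eq[OF \<open>i < n\<close> \<open>j < n\<close>] using z \<open>j < i\<close>
      by (intro sum.neutral) (metis lessThan_iff linorder_neqE_nat less_trans)
  qed
  assume i: "i < n"
  have "(\<Sum>k<n. A $$ (i, k) * B $$ (k, i)) = (\<Sum>k\<in>{i}. A $$ (i, k) * B $$ (k, i))"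
    using i z[OF i] by (intro sum.mono_neutral_right) (auto, metis nat_neq_iff)
  then show "(A * B) $$ (i, i) = A $$ (i, i) * B $$ (i, i)"
    using eq[OF i i] by simp
qed

lemma upper_triangular_pow_diag:
  fixes A :: "'a::comm_ring_1 mat"
  assumes A: "A \<in> carrier_mat n n" and ut: "upper_triangular A"
  shows "upper_triangular (A ^\<^sub>m k) \<and> (\<forall>i<n. (A ^\<^sub>m k) $$ (i, i) = (A $$ (i, i)) ^ k)"
proof (induction k)
  case 0
  then show ?case using A by (auto simp: upper_triangular_def)
next
  case (Suc k)
  have "A ^\<^sub>m k \<in> carrier_mat n n" using A by simp
  then show ?case
    using upper_triangular_mult_diag[of "A ^\<^sub>m k" n A] Suc A ut by simp
qed

text \<open>\<open>es\<close> lists the eigenvalues with algebraic multiplicity. Schur's theorem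
  gives a similar triangular matrix with diagonal \<open>es\<close>, and its powers carry the powers
  of \<open>es\<close> on the diagonal, so that one list serves all exponents.\<close>

lemma mat_trace_pow_eigenvalues:
  fixes A :: "complex mat"
  assumes A: "A \<in> carrier_mat n n"
  obtains es where "length es = n" "set es = {k. eigenvalue A k}"
    "\<And>k. mat_trace (A ^\<^sub>m k) = (\<Sum>e\<leftarrow>es. e ^ k)"
proof -
  obtain es where es: "char_poly A = (\<Prod>a\<leftarrow>es. [:- a, 1:])" "length es = n"
    using char_poly_factorized[OF A] by blast
  obtain B P Q where "schur_decomposition A es = (B, P, Q)" by (metis prod_cases3)
  from schur_decomposition[OF A es(1) this]
  have w: "similar_mat_wit A B P Q" and B: "upper_triangular B" "diag_mat B = es" by auto
  have Bc: "B \<in> carrier_mat n n" using similar_mat_witD2[OF A w] by auto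
  have "set es = {k. eigenvalue A k}"
    unfolding eigenvalue_root_char_poly[OF A] es(1)
    by (auto simp: poly_prod_list prod_list_zero_iff o_def)
  moreover have "mat_trace (A ^\<^sub>m k) = (\<Sum>e\<leftarrow>es. e ^ k)" for k
  proof -
    have "mat_trace (A ^\<^sub>m k) = mat_trace (B ^\<^sub>m k)"
      by (rule mat_trace_similar[OF similar_mat_wit_pow[OF w]])
    also have "\<dots> = (\<Sum>i<n. (B $$ (i, i)) ^ k)"
      using upper_triangular_pow_diag[OF Bc B(1), of k] Bc
      by (auto simp: mat_trace_def intro!: sum.cong)
    also have "\<dots> = (\<Sum>e\<leftarrow>es. e ^ k)"
      using Bc by (simp add: B(2)[symmetric] diag_mat_def o_def interv_sum_list_conv_sum_set_nat
          atLeast0LessThan)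
    finally show ?thesis .
  qed
  ultimately show ?thesis using that es(2) by blast
qed

text \<open>The extra factor \<open>e\<close> keeps the zeroth power sum, which is the length of the
  list, out of the right-hand side.\<close>

lemma sum_list_poly:
  fixes es :: "'a::comm_semiring_1 list"
  shows "(\<Sum>e\<leftarrow>es. e * poly p e) =
    (\<Sum>i\<le>degree p. Polynomial.coeff p i * (\<Sum>e\<leftarrow>es. e ^ Suc i))"
proof (induction es)
  case (Cons e es)
  have "e * poly p e = (\<Sum>i\<le>degree p. Polynomial.coeff p i * e ^ Suc i)"
    by (simp add: poly_altdef sum_distrib_left mult.left_commute)
  with Cons show ?case by (simp add: sum.distrib distrib_left)
qed simp

text \<open>Otherwise evaluate a polynomial that vanishes at the other eigenvalues.\<close>
lemma power_sums_zero_imp_not_one: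
  fixes es :: "complex list"
  assumes "\<And>k. (\<Sum>e\<leftarrow>es. e ^ Suc k) = 0"
  shows "1 \<notin> set es"
proof
  assume 1: "1 \<in> set es"
  define p where "p = (\<Prod>a\<in>set es - {1}. [:- a, 1:])"
  have "(\<Sum>e\<leftarrow>es. e * poly p e) = 0" by (simp only: sum_list_poly assms) simp
  moreover have "e * poly p e = (if e = 1 then poly p 1 else 0)" if "e \<in> set es" for e
    using that by (auto simp: p_def poly_prod)
  then have "(\<Sum>e\<leftarrow>es. e * poly p e) = (\<Sum>e\<leftarrow>es. if e = 1 then poly p 1 else 0)"
    by (intro arg_cong[where f = sum_list] map_cong) auto
  moreover have "\<dots> = of_nat (count_list es 1) * poly p 1"
    by (induction es) (auto simp: algebra_simps)
  moreover have "poly p 1 \<noteq> 0" by (auto simp: p_def poly_prod)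
  moreover have "count_list es 1 \<noteq> 0" using 1 by (simp add: count_list_0_iff)
  ultimately show False by simp
qed

section \<open>Traces of finite-dimensional irreducible representations\<close>

lemma representation_onD:
  assumes "representation_on X \<pi>"
  shows "complex_vector.subspace X"
    and "x \<in> X \<Longrightarrow> \<pi> b x \<in> X"
    and "x \<in> X \<Longrightarrow> y \<in> X \<Longrightarrow> \<pi> b (x + y) = \<pi> b x + \<pi> b y"
    and "x \<in> X \<Longrightarrow> \<pi> b (c *\<^sub>C x) = c *\<^sub>C \<pi> b x"
    and "x \<in> X \<Longrightarrow> \<pi> (a + b) x = \<pi> a x + \<pi> b x"
    and "x \<in> X \<Longrightarrow> \<pi> (c *\<^sub>C b) x = c *\<^sub>C \<pi> b x"
    and "x \<in> X \<Longrightarrow> \<pi> (a * b) x = \<pi> a (\<pi> b x)"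
  using assms unfolding representation_on_def by blast+

lemma representation_on_zero: "representation_on X \<pi> \<Longrightarrow> \<pi> b 0 = 0"
  using representation_onD(4)[of X \<pi> 0 b 0] representation_onD(1) complex_vector.subspace_0
  by fastforce

lemma fd_irreducible_rep_invariant:
  assumes "fd_irreducible_rep X \<pi>" "complex_vector.subspace Y" "Y \<subseteq> X"
    and "\<And>b y. y \<in> Y \<Longrightarrow> \<pi> b y \<in> Y"
  shows "Y = {0} \<or> Y = X"
  using assms unfolding fd_irreducible_rep_def by blast

text \<open>The common kernel of all operators is invariant and, as some operator is nonzero, it is
  \<open>{0}\<close>. It contains \<open>x - \<pi> 1 x\<close>.\<close>

lemma fd_irreducible_rep_one:
  assumes irr: "fd_irreducible_rep X \<pi>" and x: "x \<in> X"
  shows "\<pi> 1 x = x"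
proof -
  have rep: "representation_on X \<pi>" using irr by (simp add: fd_irreducible_rep_def)
  note r = representation_onD[OF rep]
  define Y where "Y = {x \<in> X. \<forall>b. \<pi> b x = 0}"
  have "complex_vector.subspace Y"
    unfolding Y_def using r(1,3,4) representation_on_zero[OF rep]
    by (auto simp: complex_vector.subspace_def)
  moreover have "\<pi> b y \<in> Y" if "y \<in> Y" for b y
    using that r(1) complex_vector.subspace_0 representation_on_zero[OF rep]
    by (auto simp: Y_def)
  ultimately have "Y = {0} \<or> Y = X"
    using fd_irreducible_rep_invariant[OF irr, of Y] by (auto simp: Y_def)
  moreover have "Y \<noteq> X"
    using irr unfolding fd_irreducible_rep_def nonzero_on_def Y_def by blast
  ultimately have Y: "Y = {0}" by blast
  define z where "z = x + (- 1) *\<^sub>C \<pi> 1 x"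
  have "z \<in> X" unfolding z_def
    using r(1,2) x by (intro complex_vector.subspace_add complex_vector.subspace_scale) auto
  moreover have "\<pi> b z = 0" for b
  proof -
    have "\<pi> b z = \<pi> b x + (- 1) *\<^sub>C \<pi> b (\<pi> 1 x)"
      unfolding z_def using r(1,2) x
      by (simp only: r(3) r(4) complex_vector.subspace_scale)
    also have "\<pi> b (\<pi> 1 x) = \<pi> b x" using r(7)[OF x, of b 1] by simp
    finally show ?thesis by (simp add: complex_vector.scale_minus_left)
  qed
  ultimately have "z = 0" using Y by (auto simp: Y_def)
  then show ?thesis by (simp add: z_def complex_vector.scale_minus_left)
qed

text \<open>The orbit of \<open>u\<close> is an invariant subspace; it contains \<open>u\<close>
  because \<open>1\<close> acts as the identity.\<close>

lemma fd_irreducible_rep_cyclic: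
  assumes irr: "fd_irreducible_rep X \<pi>" and u: "u \<in> X" "u \<noteq> 0" and x: "x \<in> X"
  shows "\<exists>c. \<pi> c u = x"
proof -
  have rep: "representation_on X \<pi>" using irr by (simp add: fd_irreducible_rep_def)
  note r = representation_onD[OF rep]
  define Y where "Y = range (\<lambda>b. \<pi> b u)"
  have "complex_vector.subspace Y"
    unfolding complex_vector.subspace_def Y_def
  proof (intro conjI ballI allI)
    show "0 \<in> range (\<lambda>b. \<pi> b u)"
      using r(6)[OF u(1), of 0 0] by (metis complex_vector.scale_zero_left rangeI)
  qed (auto simp: r(5)[OF u(1), symmetric] r(6)[OF u(1), symmetric])
  moreover have "\<pi> b y \<in> Y" if "y \<in> Y" for b y
    using that r(7)[OF u(1), symmetric] by (auto simp: Y_def)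
  moreover have "Y \<subseteq> X" using r(2)[OF u(1)] by (auto simp: Y_def)
  moreover have "u \<in> Y" unfolding Y_def by (metis fd_irreducible_rep_one irr rangeI u(1))
  ultimately have "Y = X" using fd_irreducible_rep_invariant[OF irr, of Y] u(2) by blast
  then show ?thesis using x by (auto simp: Y_def)
qed

text \<open>Coordinates with respect to a basis turn operators into matrices. The last clause comes
  from cyclicity: if \<open>\<pi> d x\<close> is nonzero, some \<open>c\<close> carries it back to
  \<open>x\<close>, so \<open>c * d\<close> fixes \<open>x\<close>.\<close>

lemma fd_irreducible_rep_matrix:
  fixes \<pi> :: "'b::complex_algebra_1 \<Rightarrow> 'x::complex_vector \<Rightarrow> 'x"
  assumes irr: "fd_irreducible_rep X \<pi>"
  obtains n and M :: "'b \<Rightarrow> complex mat" where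
    "\<And>b. M b \<in> carrier_mat n n"
    "\<And>a b. M (a + b) = M a + M b"
    "\<And>c b. M (c *\<^sub>C b) = c \<cdot>\<^sub>m M b"
    "\<And>a b. M (a * b) = M a * M b"
    "M 1 = 1\<^sub>m n"
    "\<And>d. nonzero_on X (\<pi> d) \<Longrightarrow> \<exists>c. eigenvalue (M (c * d)) 1"
proof -
  have rep: "representation_on X \<pi>" using irr by (simp add: fd_irreducible_rep_def)
  note r = representation_onD[OF rep]
  obtain S where S: "finite S" "X = complex_vector.span S"
    using irr unfolding fd_irreducible_rep_def by blast
  obtain Bs where Bs: "Bs \<subseteq> S" "complex_vector.independent Bs"
    "complex_vector.span Bs = complex_vector.span S"
    using complex_vector.maximal_independent_subset[of S] complex_vector.span_mono
      complex_vector.span_span by (metis subset_antisym)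
  have spn: "complex_vector.span Bs = X" using Bs S by simp
  obtain bs where bs: "set bs = Bs" "distinct bs"
    using finite_distinct_list[OF finite_subset[OF Bs(1) S(1)]] by blast
  define n where "n = length bs"
  define R where "R v i = complex_vector.representation Bs v (bs ! i)" for v i
  have bX: "bs ! j \<in> X" if "j < n" for j
    using that bs spn complex_vector.span_base nth_mem unfolding n_def by metis
  have R_add: "R (v + w) i = R v i + R w i" if "v \<in> X" "w \<in> X" for v w i
    unfolding R_def using complex_vector.representation_add[OF Bs(2)] that spn by simp
  have R_scale: "R (c *\<^sub>C v) i = c * R v i" if "v \<in> X" for c v i
    unfolding R_def using complex_vector.representation_scale[OF Bs(2)] that spn by simp
  have R_sum: "R (\<Sum>j\<in>J. g j) i = (\<Sum>j\<in>J. R (g j) i)" if "\<And>j. j \<in> J \<Longrightarrow> g j \<in> X"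
    for J :: "nat set" and g i
    unfolding R_def by (subst complex_vector.representation_sum[OF Bs(2)]) (auto simp: spn that)
  have expand: "(\<Sum>i<n. R v i *\<^sub>C bs ! i) = v" if "v \<in> X" for v
  proof -
    have "(\<Sum>b\<in>Bs. complex_vector.representation Bs v b *\<^sub>C b) = v"
      using complex_vector.sum_representation_eq[OF Bs(2)] that spn bs(1) by auto
    then show ?thesis
      using sum.reindex_bij_betw[OF bij_betw_nth[OF bs(2) refl bs(1)[symmetric]],
          of "\<lambda>b. complex_vector.representation Bs v b *\<^sub>C b"]
      by (simp add: R_def n_def)
  qed
  \<comment> \<open>Membership in \<open>X\<close> is proved along with the formula, since
    \<open>\<pi> b\<close> is known to be additive only on \<open>X\<close>.\<close>
  have pi_sum: "(\<Sum>j<m. c j *\<^sub>C bs ! j) \<in> X \<and> \<pi> b (\<Sum>j<m. c j *\<^sub>C bs ! j) = (\<Sum>j<m. c j *\<^sub>C \<pi> b (bs ! j))"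
    if "m \<le> n" for m c b
    using that
  proof (induction m)
    case 0
    then show ?case using r(1) representation_on_zero[OF rep] complex_vector.subspace_0 by auto
  next
    case (Suc m)
    have "c m *\<^sub>C bs ! m \<in> X" 
      using Suc.prems by (intro complex_vector.subspace_scale[OF r(1)] bX) simp
    then show ?case using Suc r(1,3,4) bX complex_vector.subspace_add by auto
  qed
  have R_pi: "R (\<pi> b v) i = (\<Sum>j<n. R (\<pi> b (bs ! j)) i * R v j)" if v: "v \<in> X" for b v i
  proof -
    have "R (\<pi> b v) i = R (\<Sum>j<n. R v j *\<^sub>C \<pi> b (bs ! j)) i"
      using pi_sum[of n "R v" b] expand[OF v] by simp
    also have "\<dots> = (\<Sum>j<n. R (\<pi> b (bs ! j)) i * R v j)"
      by (subst R_sum) (auto simp: R_scale mult.commute bX r(2)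
          intro!: complex_vector.subspace_scale[OF r(1)])
    finally show ?thesis .
  qed
  define M where "M b = mat n n (\<lambda>(i, j). R (\<pi> b (bs ! j)) i)" for b
  have eig: "\<exists>c. eigenvalue (M (c * d)) 1" if d: "nonzero_on X (\<pi> d)" for d
  proof -
    obtain x where x: "x \<in> X" "\<pi> d x \<noteq> 0" using d unfolding nonzero_on_def by blast
    obtain c where "\<pi> c (\<pi> d x) = x"
      using fd_irreducible_rep_cyclic[OF irr r(2)[OF x(1)] x(2) x(1)] by blast
    then have e: "\<pi> (c * d) x = x" using r(7)[OF x(1)] by simp
    have "x \<noteq> 0" using x representation_on_zero[OF rep] by auto
    have "\<exists>i<n. R x i \<noteq> 0"
    proof (rule ccontr)
      assume "\<not> (\<exists>i<n. R x i \<noteq> 0)"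
      then have "(\<Sum>i<n. R x i *\<^sub>C bs ! i) = 0" by (intro sum.neutral) auto
      then show False using expand[OF x(1)] \<open>x \<noteq> 0\<close> by simp
    qed
    then obtain i where i: "i < n" "R x i \<noteq> 0" by blast
    have "M (c * d) *\<^sub>v vec n (R x) = 1 \<cdot>\<^sub>v vec n (R x)"
    proof (rule eq_vecI)
      fix i assume "i < dim_vec (1 \<cdot>\<^sub>v vec n (R x))"
      then have i: "i < n" by simp
      then have "(M (c * d) *\<^sub>v vec n (R x)) $ i = (\<Sum>j<n. R (\<pi> (c * d) (bs ! j)) i * R x j)"
        by (simp add: M_def scalar_prod_def atLeast0LessThan)
      also have "\<dots> = R x i" by (simp only: R_pi[OF x(1), symmetric] e)
      finally show "(M (c * d) *\<^sub>v vec n (R x)) $ i = (1 \<cdot>\<^sub>v vec n (R x)) $ i"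
        using i by simp
    qed (simp add: M_def)
    moreover have "vec n (R x) \<noteq> 0\<^sub>v n" using i by (metis index_vec index_zero_vec(1))
    ultimately show ?thesis
      unfolding eigenvalue_def eigenvector_def
      by (intro exI[of _ c] exI[of _ "vec n (R x)"]) (simp add: M_def)
  qed
  show thesis
  proof (rule that[of M n])
    show "M b \<in> carrier_mat n n" for b by (simp add: M_def)
    show "M (a + b) = M a + M b" for a b
      using bX r(2,5) by (intro eq_matI) (auto simp: M_def R_add)
    show "M (c *\<^sub>C b) = c \<cdot>\<^sub>m M b" for c b
      using bX r(2,6) by (intro eq_matI) (auto simp: M_def R_scale)
    show "M (a * b) = M a * M b" for a b
    proof (rule eq_matI)
      fix i j assume "i < dim_row (M a * M b)" "j < dim_col (M a * M b)"
      then have ij: "i < n" "j < n" by (auto simp: M_def)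
      have v: "\<pi> b (bs ! j) \<in> X" using r(2) bX ij by blast
      have "M (a * b) $$ (i, j) = R (\<pi> a (\<pi> b (bs ! j))) i"
        using ij r(7)[OF bX] by (simp add: M_def)
      also have "\<dots> = (M a * M b) $$ (i, j)"
        using ij by (simp add: R_pi[OF v] M_def scalar_prod_def atLeast0LessThan)
      finally show "M (a * b) $$ (i, j) = (M a * M b) $$ (i, j)" .
    qed (auto simp: M_def)
    show "M 1 = 1\<^sub>m n"
    proof (rule eq_matI)
      fix i j assume "i < dim_row (1\<^sub>m n)" "j < dim_col (1\<^sub>m n)"
      then have ij: "i < n" "j < n" by auto
      have "M 1 $$ (i, j) = R (bs ! j) i"
        using ij fd_irreducible_rep_one[OF irr bX] by (simp add: M_def)
      also have "\<dots> = 1\<^sub>m n $$ (i, j)"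
        using ij bs complex_vector.representation_basis[OF Bs(2), of "bs ! j"]
        by (auto simp: R_def n_def nth_eq_iff_index_eq)
      finally show "M 1 $$ (i, j) = 1\<^sub>m n $$ (i, j)" .
    qed (auto simp: M_def)
    show "\<exists>c. eigenvalue (M (c * d)) 1" if "nonzero_on X (\<pi> d)" for d
      using eig[OF that] .
  qed
qed

text \<open>The image of an inverse of \<open>z *\<^sub>C 1 - b\<close> would be a left inverse of a
  matrix that kills an eigenvector.\<close>

lemma eigenvalue_matrix_hom_in_spectrum:
  fixes M :: "'b::complex_algebra_1 \<Rightarrow> complex mat"
  assumes M: "\<And>b. M b \<in> carrier_mat n n"
    "\<And>a b. M (a + b) = M a + M b"
    "\<And>c b. M (c *\<^sub>C b) = c \<cdot>\<^sub>m M b"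
    "\<And>a b. M (a * b) = M a * M b"
    "M 1 = 1\<^sub>m n"
    and z: "eigenvalue (M b) z"
  shows "z \<in> alg_spectrum b"
proof (rule ccontr)
  assume "z \<notin> alg_spectrum b"
  then obtain c where "c * (z *\<^sub>C 1 - b) = 1"
    by (auto simp: alg_spectrum_def alg_invertible_def)
  \<comment> \<open>The sign moves to \<open>c\<close> because \<open>char_matrix\<close> stands for
    the matrix minus \<open>z\<close> times the identity.\<close>
  then have c: "(- c) * (b + (- z) *\<^sub>C 1) = 1"
    by (simp add: complex_vector.scale_minus_left right_diff_distrib)
  have "M (b + (- z) *\<^sub>C 1) = char_matrix (M b) z"
    using M(1)[of b] by (simp only: M(2,3,5) char_matrix_def) simp
  then obtain v where v: "v \<in> carrier_vec n" "v \<noteq> 0\<^sub>v n" "M (b + (- z) *\<^sub>C 1) *\<^sub>v v = 0\<^sub>v n"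
    using z unfolding eigenvalue_def eigenvector_char_matrix[OF M(1)] by auto
  have "M (- c) *\<^sub>v (M (b + (- z) *\<^sub>C 1) *\<^sub>v v) = M ((- c) * (b + (- z) *\<^sub>C 1)) *\<^sub>v v"
    unfolding M(4) using M(1) v(1) by (intro assoc_mult_mat_vec[symmetric, of _ n n _ n]) auto
  also have "\<dots> = v" using v(1) by (simp only: c M(5)) simp
  finally show False using v M(1)[of "- c"] by auto
qed

text \<open>The functional \<open>t\<close> is the trace of the representation and \<open>N\<close> its degree.\<close>
lemma fd_irreducible_rep_trace:
  fixes \<pi> :: "'b::complex_banach_algebra_1 \<Rightarrow> 'x::complex_vector \<Rightarrow> 'x"
  assumes irr: "fd_irreducible_rep X \<pi>"
  obtains t :: "'b \<Rightarrow> complex" and N :: real where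
    "\<And>a b. t (a + b) = t a + t b"
    "\<And>c b. t (c *\<^sub>C b) = c * t b"
    "\<And>a b. t (a * b) = t (b * a)"
    "0 \<le> N" "\<And>b. cmod (t b) \<le> N * alg_spectral_radius b"
    "\<And>d. nonzero_on X (\<pi> d) \<Longrightarrow> \<exists>c. t (c * d) \<noteq> 0"
    "\<And>b::'b. alg_spectrum b \<noteq> {}"
proof -
  obtain n M where M: "\<And>b::'b. M b \<in> carrier_mat n n"
    "\<And>a b. M (a + b) = M a + M b"
    "\<And>c b. M (c *\<^sub>C b) = c \<cdot>\<^sub>m M b"
    "\<And>a b. M (a * b) = M a * M b"
    "M 1 = 1\<^sub>m n"
    and eig: "\<And>d. nonzero_on X (\<pi> d) \<Longrightarrow> \<exists>c. eigenvalue (M (c * d)) 1"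
    using fd_irreducible_rep_matrix[OF irr] by metis
  note spec = eigenvalue_matrix_hom_in_spectrum[of M, OF M]
  have pow: "M (b ^ k) = M b ^\<^sub>m k" for b k
    using M(1)[of b] by (induction k) (simp_all add: M(4,5) power_commutes[symmetric])
  define t where "t b = mat_trace (M b)" for b
  \<comment> \<open>The trace is a sum of \<open>n\<close> eigenvalues, all of which lie in the
    spectrum of \<open>b\<close>.\<close>
  have bnd: "cmod (t b) \<le> n * alg_spectral_radius b" for b
  proof -
    obtain es where es: "length es = n" "set es = {k. eigenvalue (M b) k}"
      "\<And>k. mat_trace (M b ^\<^sub>m k) = (\<Sum>e\<leftarrow>es. e ^ k)"
      using mat_trace_pow_eigenvalues[OF M(1)[of b]] by metis
    have "t b = (\<Sum>e\<leftarrow>es. e)"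
      using es(3)[of 1] M(1)[of b] by (simp add: t_def)
    have sum_le: "cmod (\<Sum>e\<leftarrow>es'. e) \<le> length es' * alg_spectral_radius b"
      if "set es' \<subseteq> alg_spectrum b" for es'
      using that
    proof (induction es')
      case (Cons e es')
      then show ?case
        using norm_triangle_ineq[of e "\<Sum>e\<leftarrow>es'. e"] alg_spectrum_le_radius[of e b]
        by (auto simp: algebra_simps)
    qed simp
    have "set es \<subseteq> alg_spectrum b" using es(2) spec by auto
    from sum_le[OF this] show ?thesis using es(1) \<open>t b = (\<Sum>e\<leftarrow>es. e)\<close> by simp
  qed
  \<comment> \<open>If \<open>t\<close> vanished on all left multiples of \<open>d\<close>, it would
    vanish on every positive power of \<open>c * d\<close>, each being such a multiple. Then all
    power sums of the eigenvalues are zero, although \<open>1\<close> is an eigenvalue.\<close>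
  have nondeg: "\<exists>c. t (c * d) \<noteq> 0" if d: "nonzero_on X (\<pi> d)" for d
  proof (rule ccontr)
    assume "\<nexists>c. t (c * d) \<noteq> 0"
    then have z: "t (c * d) = 0" for c by simp
    obtain c where c: "eigenvalue (M (c * d)) 1" using eig[OF d] by blast
    obtain es where es: "length es = n" "set es = {k. eigenvalue (M (c * d)) k}"
      "\<And>k. mat_trace (M (c * d) ^\<^sub>m k) = (\<Sum>e\<leftarrow>es. e ^ k)"
      using mat_trace_pow_eigenvalues[OF M(1)[of "c * d"]] by metis
    have "(\<Sum>e\<leftarrow>es. e ^ Suc k) = 0" for k
    proof -
      have "(\<Sum>e\<leftarrow>es. e ^ Suc k) = t ((c * d) ^ Suc k)"
        unfolding t_def pow es(3) ..
      also have "\<dots> = t (((c * d) ^ k * c) * d)" by (simp only: power_Suc2 mult.assoc)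
      finally show ?thesis by (simp only: z)
    qed
    then have "1 \<notin> set es" by (rule power_sums_zero_imp_not_one)
    then show False using es(2) c by simp
  qed
  \<comment> \<open>In dimension \<open>0\<close> there are no eigenvectors, so \<open>n\<close> is
    nonzero. Hence every \<open>M b\<close> has an eigenvalue, and this lies in the spectrum of
    \<open>b\<close>.\<close>
  obtain b0 where "nonzero_on X (\<pi> b0)" using irr unfolding fd_irreducible_rep_def by blast
  then obtain c where "eigenvalue (M (c * b0)) 1" using eig by blast
  then have "n \<noteq> 0"
    using M(1)[of "c * b0"] unfolding eigenvalue_def eigenvector_def
    by (auto intro!: eq_vecI)
  then have ne: "alg_spectrum b \<noteq> {}" for b :: 'b
  proof -
    obtain es where "length es = n" "set es = {k. eigenvalue (M b) k}"
      using mat_trace_pow_eigenvalues[OF M(1)[of b]] by metis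
    moreover from this have "hd es \<in> set es" using \<open>n \<noteq> 0\<close> by (intro hd_in_set) auto
    ultimately show ?thesis using spec by blast
  qed
  show thesis
  proof (rule that[of t n])
    show "t (a + b) = t a + t b" for a b
      using M(1)[of a] M(1)[of b] by (simp add: t_def M(2) mat_trace_def sum.distrib)
    show "t (c *\<^sub>C b) = c * t b" for c b
      using M(1)[of b] by (simp add: t_def M(3) mat_trace_def sum_distrib_left)
    show "t (a * b) = t (b * a)" for a b
      unfolding t_def M(4) by (rule mat_trace_mult_commute[OF M(1) M(1)])
  qed (use bnd nondeg ne in auto)
qed

section \<open>Vector-valued polynomials\<close>

text \<open>Polynomial curves in Horner form, with no topology involved. A linear functional maps
  them to scalar polynomials, so Cauchy estimates apply without continuity of \<open>T\<close> or of
  the trace.\<close>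

inductive vpoly :: "(complex \<Rightarrow> 'a::complex_vector) \<Rightarrow> bool" where
  vpoly_const: "vpoly (\<lambda>_. a)"
| vpoly_pCons: "vpoly f \<Longrightarrow> vpoly (\<lambda>z. a + z *\<^sub>C f z)"

lemma vpoly_shift: "vpoly f \<Longrightarrow> vpoly (\<lambda>z. z *\<^sub>C f z)"
  using vpoly_pCons[of f 0] by simp

lemma vpoly_linear:
  assumes "\<And>x y. L (x + y) = L x + L y" "\<And>c x. L (c *\<^sub>C x) = c *\<^sub>C L x" and "vpoly f"
  shows "vpoly (\<lambda>z. L (f z))"
  using assms(3) by induction (auto simp: assms(1,2) intro: vpoly_const vpoly_pCons)

lemma vpoly_add:
  assumes "vpoly f" "vpoly g"
  shows "vpoly (\<lambda>z. f z + g z)"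
  using assms
proof (induction arbitrary: g)
  case (vpoly_const a)
  then show ?case
  proof cases
    case (vpoly_const b)
    then show ?thesis using vpoly.vpoly_const[of "a + b"] by simp
  next
    case (vpoly_pCons f b)
    then show ?thesis using vpoly.vpoly_pCons[of f "a + b"] by (simp add: add.assoc)
  qed
next
  case (vpoly_pCons f a)
  from vpoly_pCons.prems show ?case
  proof cases
    case (vpoly_const b)
    then show ?thesis using vpoly.vpoly_pCons[OF vpoly_pCons.hyps, of "a + b"] by (simp add: ac_simps)
  next
    case (vpoly_pCons g' b)
    then show ?thesis
      using vpoly.vpoly_pCons[OF vpoly_pCons.IH[OF vpoly_pCons(2)], of "a + b"]
      by (simp add: ac_simps scaleC_add_right)
  qed
qed

lemma vpoly_mult:
  fixes f g :: "complex \<Rightarrow> 'a::complex_algebra_1"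
  assumes "vpoly f" "vpoly g"
  shows "vpoly (\<lambda>z. f z * g z)"
  using assms(1)
proof induction
  case (vpoly_const a)
  show ?case
    by (rule vpoly_linear[OF _ _ assms(2)]) (simp_all add: distrib_left mult_scaleC_right)
next
  case (vpoly_pCons f a)
  have "vpoly (\<lambda>z. a * g z)"
    by (rule vpoly_linear[OF _ _ assms(2)]) (simp_all add: distrib_left mult_scaleC_right)
  from vpoly_add[OF this vpoly_shift[OF vpoly_pCons.IH]] show ?case
    by (simp add: distrib_right mult_scaleC_left)
qed

lemma vpoly_functional:
  fixes t :: "'a::complex_vector \<Rightarrow> complex"
  assumes t: "\<And>x y. t (x + y) = t x + t y" "\<And>c x. t (c *\<^sub>C x) = c * t x" and "vpoly f"
  shows "\<exists>p. \<forall>z. t (f z) = poly p z"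
  using assms(3)
proof induction
  case (vpoly_const a)
  show ?case by (rule exI[of _ "[:t a:]"]) simp
next
  case (vpoly_pCons f a)
  then obtain p where "\<forall>z. t (f z) = poly p z" by blast
  then show ?case by (intro exI[of _ "pCons (t a) p"]) (simp add: t)
qed

section \<open>Cauchy estimates for coefficients\<close>

lemma higher_deriv_poly: "(deriv ^^ k) (poly p) = poly ((pderiv ^^ k) p)"
  for p :: "complex poly"
  by (induction k) (auto intro!: ext DERIV_imp_deriv poly_DERIV)

lemma cauchy_coeff_bound:
  fixes p :: "complex poly"
  assumes "0 < r" "\<And>z. cmod z = r \<Longrightarrow> cmod (poly p z) \<le> B"
  shows "cmod (Polynomial.coeff p k) * r ^ k \<le> B"
proof -
  have "cmod ((deriv ^^ k) (poly p) 0) \<le> fact k * B / r ^ k"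
    using assms by (intro Cauchy_inequality) (auto intro!: holomorphic_intros continuous_intros)
  moreover have "(deriv ^^ k) (poly p) 0 = fact k * Polynomial.coeff p k"
    by (simp add: higher_deriv_poly poly_0_coeff_0 coeff_higher_pderiv pochhammer_fact)
  ultimately have "fact k * cmod (Polynomial.coeff p k) \<le> fact k * (B / r ^ k)"
    by (simp add: norm_mult)
  then have "cmod (Polynomial.coeff p k) \<le> B / r ^ k"
    by (simp only: mult_le_cancel_left_pos[OF fact_gt_zero])
  then show ?thesis using assms(1) by (simp add: field_simps)
qed

text \<open>The list \<open>as\<close> holds the lowest coefficients of a curve and \<open>g\<close>
  the remainder, so the \<open>foldr\<close> expression is the curve itself, written by Horner's
  scheme.\<close>

lemma vpoly_coeff_bound:
  fixes t :: "'a::complex_vector \<Rightarrow> complex"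
  assumes t: "\<And>x y. t (x + y) = t x + t y" "\<And>c x. t (c *\<^sub>C x) = c * t x"
    and g: "vpoly g" and r: "0 < r"
    and bnd: "\<And>z. cmod z = r \<Longrightarrow> cmod (t (foldr (\<lambda>a w. a + z *\<^sub>C w) as (g z))) \<le> B"
    and k: "k < length as"
  shows "cmod (t (as ! k)) * r ^ k \<le> B"
proof -
  have "\<exists>q. (\<forall>z. t (foldr (\<lambda>a w. a + z *\<^sub>C w) as (g z)) = poly q z) \<and>
      (\<forall>k<length as. Polynomial.coeff q k = t (as ! k))"
  proof (induction as)
    case Nil
    then show ?case using vpoly_functional[OF t g] by simp
  next
    case (Cons a as)
    then obtain q where "\<forall>z. t (foldr (\<lambda>a w. a + z *\<^sub>C w) as (g z)) = poly q z"
      "\<forall>k<length as. Polynomial.coeff q k = t (as ! k)" by blast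
    then show ?case
      by (intro exI[of _ "pCons (t a) q"]) (auto simp: t coeff_pCons split: nat.split)
  qed
  then show ?thesis using cauchy_coeff_bound[OF r, of _ B k] bnd k by metis
qed

text \<open>A polynomial curve with expansion \<open>z x + z^2 d + O(z^3)\<close> at
  \<open>0\<close>.\<close>

definition germ2 :: "(complex \<Rightarrow> 'a::complex_vector) \<Rightarrow> 'a \<Rightarrow> 'a \<Rightarrow> bool" where
  "germ2 f x d \<longleftrightarrow> (\<exists>g. vpoly g \<and> f = (\<lambda>z. z *\<^sub>C (x + z *\<^sub>C (d + z *\<^sub>C g z))))"

lemma germ2_identity: "germ2 (\<lambda>z. z *\<^sub>C x) x 0"
  unfolding germ2_def by (rule exI[of _ "\<lambda>_. 0"]) (simp add: vpoly_const)

lemma germ2_linear: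
  assumes "\<And>x y. L (x + y) = L x + L y" "\<And>c x. L (c *\<^sub>C x) = c *\<^sub>C L x" and "germ2 f x d"
  shows "germ2 (\<lambda>z. L (f z)) (L x) (L d)"
proof -
  obtain g where "vpoly g" "f = (\<lambda>z. z *\<^sub>C (x + z *\<^sub>C (d + z *\<^sub>C g z)))"
    using assms(3) unfolding germ2_def by blast
  then show ?thesis
    unfolding germ2_def using vpoly_linear[of L, OF assms(1,2)]
    by (intro exI[of _ "\<lambda>z. L (g z)"]) (simp add: assms(1,2))
qed

lemma germ2_scaleC: "germ2 f x d \<Longrightarrow> germ2 (\<lambda>z. c *\<^sub>C f z) (c *\<^sub>C x) (c *\<^sub>C d)"
  by (rule germ2_linear) (simp_all add: scaleC_add_right scaleC_scaleC mult.commute)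

lemma germ2_add:
  assumes "germ2 f x d" "germ2 f' x' d'"
  shows "germ2 (\<lambda>z. f z + f' z) (x + x') (d + d')"
proof -
  obtain g g' where "vpoly g" "f = (\<lambda>z. z *\<^sub>C (x + z *\<^sub>C (d + z *\<^sub>C g z)))"
    "vpoly g'" "f' = (\<lambda>z. z *\<^sub>C (x' + z *\<^sub>C (d' + z *\<^sub>C g' z)))"
    using assms unfolding germ2_def by blast
  then show ?thesis
    unfolding germ2_def
    by (intro exI[of _ "\<lambda>z. g z + g' z"]) (simp add: vpoly_add scaleC_add_right ac_simps)
qed

text \<open>This goes one order beyond \<open>germ2_square\<close>: the cubic coefficient
  \<open>x * d + d * x\<close> later gives access to the trace of \<open>x * d\<close>.\<close>

lemma germ2_square_expansion:
  fixes f :: "complex \<Rightarrow> 'a::complex_algebra_1"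
  assumes "germ2 f x d"
  shows "\<exists>g. vpoly g \<and> (\<forall>z. f z * f z =
    0 + z *\<^sub>C (0 + z *\<^sub>C (x * x + z *\<^sub>C ((x * d + d * x) + z *\<^sub>C g z))))"
proof -
  obtain g where g: "vpoly g" "f = (\<lambda>z. z *\<^sub>C (x + z *\<^sub>C (d + z *\<^sub>C g z)))"
    using assms unfolding germ2_def by blast
  define h where "h z = d + z *\<^sub>C g z" for z
  have h: "vpoly h" using vpoly_pCons[OF g(1), of d] by (simp add: h_def[abs_def])
  have "vpoly (\<lambda>z. (g z * x + x * g z) + h z * h z)"
    by (intro vpoly_add vpoly_mult g h vpoly_const)
  moreover have "f z * f z =
    0 + z *\<^sub>C (0 + z *\<^sub>C (x * x + z *\<^sub>C ((x * d + d * x) + z *\<^sub>C ((g z * x + x * g z) + h z * h z))))" for z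
  proof -
    have "(x + z *\<^sub>C h z) * (x + z *\<^sub>C h z) =
        x * x + z *\<^sub>C (x * h z + h z * x + z *\<^sub>C (h z * h z))"
      by (simp add: distrib_left distrib_right mult_scaleC_left mult_scaleC_right scaleC_add_right
          scaleC_scaleC add.assoc)
    moreover have "x * h z + h z * x = x * d + d * x + z *\<^sub>C (g z * x + x * g z)"
      by (simp add: h_def distrib_left distrib_right mult_scaleC_left mult_scaleC_right
          scaleC_add_right ac_simps)
    moreover have "f z * f z = z *\<^sub>C (z *\<^sub>C ((x + z *\<^sub>C h z) * (x + z *\<^sub>C h z)))"
      by (simp add: g(2) h_def mult_scaleC_left mult_scaleC_right)
    ultimately show ?thesis by (simp add: scaleC_add_right add.assoc)
  qed
  ultimately show ?thesis by blast
qed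

lemma germ2_square:
  fixes f :: "complex \<Rightarrow> 'a::complex_algebra_1"
  assumes "germ2 f x d"
  shows "germ2 (\<lambda>z. f z * f z) 0 (x * x)"
proof -
  obtain g where g: "vpoly g" "\<And>z. f z * f z =
    0 + z *\<^sub>C (0 + z *\<^sub>C (x * x + z *\<^sub>C ((x * d + d * x) + z *\<^sub>C g z)))"
    using germ2_square_expansion[OF assms] by blast
  show ?thesis
    unfolding germ2_def
    by (rule exI[of _ "\<lambda>z. (x * d + d * x) + z *\<^sub>C g z"])
       (simp add: g(2) vpoly_pCons[OF g(1)])
qed

section \<open>Spectral isometries\<close>

lemma power_mult_commuting:
  fixes a b :: "'a::monoid_mult"
  assumes "a * b = b * a"
  shows "a ^ n * b ^ n = (a * b) ^ n"
proof (induction n)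
  case (Suc n)
  have "a ^ Suc n * b ^ Suc n = a * (a ^ n * b) * b ^ n" by (simp add: mult.assoc)
  also have "a ^ n * b = b * a ^ n" by (rule power_commuting_commutes[OF assms])
  also have "a * (b * a ^ n) * b ^ n = (a * b) * (a ^ n * b ^ n)" by (simp add: mult.assoc)
  finally show ?case by (simp add: Suc)
qed simp

lemma vpoly_one_plus_power:
  fixes x :: "'a::complex_algebra_1"
  shows "\<exists>g. vpoly g \<and> (\<forall>z. (1 + z *\<^sub>C x) ^ n = 1 + z *\<^sub>C (of_nat n *\<^sub>C x + z *\<^sub>C g z))"
proof (induction n)
  case 0
  show ?case by (rule exI[of _ "\<lambda>_. 0"]) (simp add: vpoly_const)
next
  case (Suc n)
  then obtain g where g: "vpoly g"
    "\<And>z. (1 + z *\<^sub>C x) ^ n = 1 + z *\<^sub>C (of_nat n *\<^sub>C x + z *\<^sub>C g z)" by blast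
  define h where "h z = (of_nat n *\<^sub>C (x * x) + z *\<^sub>C (x * g z)) + g z" for z
  have "vpoly h"
    unfolding h_def by (intro vpoly_add vpoly_pCons vpoly_mult g vpoly_const)
  moreover have "(1 + z *\<^sub>C x) ^ Suc n = 1 + z *\<^sub>C (of_nat (Suc n) *\<^sub>C x + z *\<^sub>C h z)" for z
    by (simp add: g(2) h_def distrib_left distrib_right mult_scaleC_left mult_scaleC_right
        scaleC_add_right scaleC_add_left scaleC_scaleC ac_simps)
  ultimately show ?case by blast
qed

text \<open>The two factors commute, and their product is the power \<open>m^2\<close> of
  \<open>1 - z^2 x^2\<close>, where \<open>z^2\<close> has modulus \<open>1 / m^2\<close>. So they
  are inverse to each other up to a bounded factor, as \<open>exp (- n z x)\<close> and
  \<open>exp (n z x)\<close> would be exactly.\<close>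

lemma norm_one_plus_power_le:
  fixes x :: "'a::complex_banach_algebra_1"
  assumes "cmod z = 1 / real m" "m > 0"
  shows "norm ((1 + (- z) *\<^sub>C x) ^ m\<^sup>2 * (1 + z *\<^sub>C x) ^ m\<^sup>2) \<le> exp ((norm x)^2)"
proof -
  have c: "(1 + (- z) *\<^sub>C x) * (1 + z *\<^sub>C x) = 1 - (z * z) *\<^sub>C (x * x)"
    "(1 + z *\<^sub>C x) * (1 + (- z) *\<^sub>C x) = 1 - (z * z) *\<^sub>C (x * x)"
    by (simp_all add: distrib_left distrib_right mult_scaleC_left mult_scaleC_right
        complex_vector.scale_minus_left scaleC_scaleC scaleC_add_right
        complex_vector.scale_right_diff_distrib left_diff_distrib right_diff_distrib)
  have "norm ((1 + (- z) *\<^sub>C x) ^ m\<^sup>2 * (1 + z *\<^sub>C x) ^ m\<^sup>2) =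
      norm ((1 - (z * z) *\<^sub>C (x * x)) ^ m\<^sup>2)"
    by (subst power_mult_commuting) (simp_all only: c)
  also have "\<dots> \<le> norm (1 - (z * z) *\<^sub>C (x * x)) ^ m\<^sup>2" by (rule norm_power_ineq)
  also have "\<dots> \<le> (1 + (norm x)^2 / real (m\<^sup>2)) ^ m\<^sup>2"
  proof (rule power_mono)
    have "norm ((z * z) *\<^sub>C (x * x)) \<le> (1 / real m)^2 * (norm x)^2"
      using norm_mult_ineq[of x x] assms
      by (simp add: norm_scaleC norm_mult power2_eq_square divide_right_mono)
    then show "norm (1 - (z * z) *\<^sub>C (x * x)) \<le> 1 + (norm x)^2 / real (m\<^sup>2)"
      using norm_triangle_ineq4[of 1 "(z * z) *\<^sub>C (x * x)"] by (simp add: power_divide)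
  qed simp
  also have "\<dots> \<le> exp ((norm x)^2 / real (m\<^sup>2)) ^ m\<^sup>2"
    by (intro power_mono exp_ge_add_one_self add_nonneg_nonneg) simp_all
  also have "\<dots> = exp ((norm x)^2)"
    using assms(2) by (simp add: exp_of_nat_mult[symmetric])
  finally show ?thesis .
qed

lemma zero_if_multiples_bounded:
  fixes A B :: real
  assumes "\<And>m::nat. m \<ge> m0 \<Longrightarrow> real m * A \<le> B"
  shows "A \<le> 0"
proof (rule ccontr)
  assume "\<not> A \<le> 0"
  then obtain m :: nat where m: "B < real m * A" using reals_Archimedean3 by (metis not_le)
  also have "\<dots> \<le> real (max m m0) * A" using \<open>\<not> A \<le> 0\<close> by (intro mult_right_mono) auto
  finally show False using assms[of "max m m0"] by simp
qed

text \<open>The curve \<open>(1 + z x)\<^sup>n y (1 - z x)\<^sup>n\<close> with \<open>n = m\<^sup>2\<close> and \<open>\<bar>z\<bar> = 1/m\<close> has spectral radius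
  bounded independently of \<open>m\<close>, while its linear coefficient is \<open>n (x y - y x)\<close>.\<close>
lemma bounded_functional_commutator:
  fixes t :: "'a::complex_banach_algebra_1 \<Rightarrow> complex"
  assumes ne: "\<And>x::'a. alg_spectrum x \<noteq> {}"
    and t: "\<And>x y. t (x + y) = t x + t y" "\<And>c x. t (c *\<^sub>C x) = c * t x"
    and bnd: "0 \<le> N" "\<And>x. cmod (t x) \<le> N * alg_spectral_radius x"
  shows "t (x * y) = t (y * x)"
proof -
  define B where "B = N * (exp ((norm x)^2) * norm y)"
  have "real m * cmod (t (x * y + (- 1) *\<^sub>C (y * x))) \<le> B" if m: "m \<ge> 1" for m :: nat
  proof -
    define n where "n = m^2"
    obtain g where g: "vpoly g"
      "\<And>z. (1 + z *\<^sub>C x) ^ n = 1 + z *\<^sub>C (of_nat n *\<^sub>C x + z *\<^sub>C g z)"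
      using vpoly_one_plus_power by blast
    obtain g' where g': "vpoly g'"
      "\<And>z. (1 + z *\<^sub>C (- x)) ^ n = 1 + z *\<^sub>C (of_nat n *\<^sub>C (- x) + z *\<^sub>C g' z)"
      using vpoly_one_plus_power by blast
    define u where "u z = of_nat n *\<^sub>C x + z *\<^sub>C g z" for z
    define v where "v z = of_nat n *\<^sub>C (- x) + z *\<^sub>C g' z" for z
    define h where "h z = (g z * y + y * g' z) + u z * y * v z" for z
    have uv: "vpoly u" "vpoly v"
      unfolding u_def v_def by (intro vpoly_pCons g g')+
    have h: "vpoly h"
      unfolding h_def by (intro vpoly_add vpoly_mult uv g g' vpoly_const)
    have eq: "foldr (\<lambda>a w. a + z *\<^sub>C w) [y, of_nat n *\<^sub>C (x * y + (- 1) *\<^sub>C (y * x))] (h z) =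
        (1 + z *\<^sub>C x) ^ n * y * (1 + (- z) *\<^sub>C x) ^ n" for z
    proof -
      have "(- z) *\<^sub>C x = z *\<^sub>C (- x)" by simp
      then have "(1 + z *\<^sub>C x) ^ n * y * (1 + (- z) *\<^sub>C x) ^ n = (1 + z *\<^sub>C u z) * y * (1 + z *\<^sub>C v z)"
        by (simp only: g(2) g'(2) u_def v_def)
      also have "\<dots> = y + z *\<^sub>C ((u z * y + y * v z) + z *\<^sub>C (u z * y * v z))"
        by (simp add: distrib_left distrib_right mult_scaleC_left mult_scaleC_right
            scaleC_add_right ac_simps)
      also have "u z * y + y * v z =
          of_nat n *\<^sub>C (x * y + (- 1) *\<^sub>C (y * x)) + z *\<^sub>C (g z * y + y * g' z)"
        by (simp add: u_def v_def distrib_left distrib_right mult_scaleC_left mult_scaleC_right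
            scaleC_add_right complex_vector.scale_right_diff_distrib complex_vector.scale_minus_left
            right_diff_distrib left_diff_distrib)
      finally show ?thesis by (simp add: h_def scaleC_add_right add.assoc)
    qed
    have "cmod (t ([y, of_nat n *\<^sub>C (x * y + (- 1) *\<^sub>C (y * x))] ! 1)) * (1 / real m) ^ 1 \<le> B"
    proof (rule vpoly_coeff_bound[OF t h])
      fix z assume z: "cmod z = 1 / real m"
      have "alg_spectral_radius ((1 + z *\<^sub>C x) ^ n * y * (1 + (- z) *\<^sub>C x) ^ n) \<le>
          norm ((1 + (- z) *\<^sub>C x) ^ n * ((1 + z *\<^sub>C x) ^ n * y))"
        by (rule alg_spectral_radius_mult_le[OF ne])
      also have "\<dots> \<le> norm ((1 + (- z) *\<^sub>C x) ^ n * (1 + z *\<^sub>C x) ^ n) * norm y"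
        by (simp only: mult.assoc[symmetric] norm_mult_ineq)
      also have "\<dots> \<le> exp ((norm x)^2) * norm y"
        unfolding n_def using m by (intro mult_right_mono norm_one_plus_power_le[OF z]) auto
      finally show "cmod (t (foldr (\<lambda>a w. a + z *\<^sub>C w)
          [y, of_nat n *\<^sub>C (x * y + (- 1) *\<^sub>C (y * x))] (h z))) \<le> B"
        unfolding eq B_def using bnd by (meson mult_left_mono order_trans)
    qed (use m in auto)
    \<comment> \<open>The coefficient carries \<open>n = m^2\<close> and the circle has radius
      \<open>1 / m\<close>, so a factor \<open>m\<close> survives.\<close>
    then have "real n * cmod (t (x * y + (- 1) *\<^sub>C (y * x))) * (1 / real m) \<le> B"
      by (simp add: t norm_mult)
    then show ?thesis using m by (simp add: n_def power2_eq_square)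
  qed
  then have "cmod (t (x * y + (- 1) *\<^sub>C (y * x))) \<le> 0" by (rule zero_if_multiples_bounded)
  then show ?thesis unfolding t by simp
qed

section \<open>Quadratic substitutes for Moebius transformations of the disc\<close>

lemma cmod_quadratic_disc:
  fixes w :: real and z :: complex
  assumes w: "0 < w" "w \<le> 1/4" and z: "(cmod z)^2 \<le> 1 + 4 * w^2"
  shows "(cmod (z + of_real w * (1 - z^2)))^2 \<le> 1 + 12 * w^2"
    and "cmod z \<le> 1 \<Longrightarrow> (cmod (z - of_real w * (1 - z^2)))^2 \<le> 1 + 4 * w^2"
proof -
  define x y s where "x = Re z" and "y = Im z" and "s = x^2 + y^2"
  have s: "(cmod z)^2 = s" by (simp add: cmod_power2 s_def x_def y_def)
  \<comment> \<open>The vector field \<open>1 - z^2\<close> is tangent to the unit circle: the term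
    linear in \<open>a\<close> has the factor \<open>1 - s\<close> and vanishes there. This is why
    only \<open>O(w^2)\<close> is lost.\<close>
  have eq: "(cmod (z + of_real a * (1 - z^2)))^2 =
      s + 2 * (a * x) * (1 - s) + a^2 * ((s + 1)^2 - 4 * x^2)" for a :: real
    unfolding cmod_power2 s_def x_def y_def
    by (simp add: power2_eq_square algebra_simps)
  have x: "x^2 \<le> s" by (simp add: s_def)
  have w2: "w^2 \<le> 1/16" using w power_mono[of w "1/4" 2] by (simp add: power2_eq_square)
  have s54: "s \<le> 5/4" using z s w2 by simp
  \<comment> \<open>Inside the disc the slack \<open>1 - s\<close> absorbs the linear term, as
    \<open>2 * (a * x) \<le> 1\<close>.\<close>
  have inner: "s + 2 * (a * x) * (1 - s) + a^2 * ((s + 1)^2 - 4 * x^2) \<le> 1 + 4 * w^2"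
    if "s \<le> 1" "\<bar>a\<bar> = w" for a
  proof -
    have "\<bar>x\<bar> \<le> 1" using x that(1) abs_square_le_1 by fastforce
    then have "\<bar>a * x\<bar> \<le> 1/4 * 1" unfolding abs_mult using w that(2) by (intro mult_mono) auto
    then have "2 * (a * x) * (1 - s) \<le> 1 * (1 - s)" using that(1) by (intro mult_right_mono) auto
    moreover have "(s + 1)^2 \<le> 2^2" using that(1) x by (intro power_mono) (auto simp: s_def)
    then have "a^2 * ((s + 1)^2 - 4 * x^2) \<le> a^2 * 4"
      by (intro mult_left_mono) (auto intro: order_trans[of _ "(s+1)^2"])
    moreover have "a^2 = w^2" using that(2) by (metis power2_abs)
    ultimately show ?thesis by simp
  qed
  show "(cmod (z + of_real w * (1 - z^2)))^2 \<le> 1 + 12 * w^2"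
  proof (cases "s \<le> 1")
    case True
    have "s + 2 * (w * x) * (1 - s) + w^2 * ((s + 1)^2 - 4 * x^2) \<le> 1 + 4 * w^2"
      using inner[OF True, of w] w by simp
    then show ?thesis unfolding eq by (rule order_trans) simp
  next
    case False
    \<comment> \<open>Now \<open>0 < s - 1 \<le> 4 * w^2\<close>, so the linear term is itself of
      order \<open>w^2\<close>. The contributions \<open>4\<close>, \<open>5/2\<close> and
      \<open>81/16\<close> add up to less than \<open>12\<close>.\<close>
    have "x^2 \<le> (5/4)^2" using x s54 by (simp add: power2_eq_square)
    then have "\<bar>x\<bar> \<le> 5/4" using abs_le_square_iff[of x "5/4"] by simp
    then have "- (w * x) \<le> 1/4 * (5/4)"
      using w mult_mono[of w "1/4" "\<bar>x\<bar>" "5/4"] abs_mult[of w x] by auto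
    then have "- (w * x) * (s - 1) \<le> 1/4 * (5/4) * (s - 1)"
      using False by (intro mult_right_mono) auto
    also have "\<dots> \<le> 1/4 * (5/4) * (4 * w^2)" using z s by simp
    finally have "2 * (w * x) * (1 - s) \<le> 5/2 * w^2" by (simp add: algebra_simps)
    moreover have "(s + 1)^2 \<le> 81/16"
      using s54 False power_mono[of "s + 1" "9/4" 2] by (simp add: power_divide)
    then have "(s + 1)^2 - 4 * x^2 \<le> 81/16"
      using zero_le_power2[of x] by linarith
    then have "w^2 * ((s + 1)^2 - 4 * x^2) \<le> w^2 * (81/16)"
      by (intro mult_left_mono) auto
    moreover have "s \<le> 1 + 4 * w^2" using z s by simp
    ultimately show ?thesis unfolding eq using zero_le_power2[of w] by linarith
  qed
  assume "cmod z \<le> 1"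
  then have "s \<le> 1" using s power_le_one[of "cmod z" 2] by simp
  then show "(cmod (z - of_real w * (1 - z^2)))^2 \<le> 1 + 4 * w^2"
    using inner[of "- w"] eq[of "- w"] w by simp
qed

text \<open>The expression is \<open>\<mu> - w (1 - \<mu>^2)\<close>, a step along the same vector
  field in the opposite direction.\<close>

lemma cmod_quadratic_outer:
  fixes w :: real
  assumes "0 < w" "w \<le> 1/4" "cmod \<mu> \<le> 1"
  shows "cmod (- of_real w + 1 * \<mu> + of_real w * \<mu>^2) \<le> sqrt (1 + 4 * w^2)"
proof -
  have "(cmod \<mu>)^2 \<le> 1 + 4 * w^2" using assms(3) power_le_one[of "cmod \<mu>" 2] by (simp add: add_increasing2)
  from cmod_quadratic_disc(2)[OF assms(1,2) this assms(3)] show ?thesis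
    by (intro real_le_rsqrt) (simp add: algebra_simps)
qed

text \<open>The expression is \<open>b - w b^2\<close> at \<open>b = w + \<mu>\<close>. It differs
  from \<open>\<mu> + w (1 - \<mu>^2)\<close> by \<open>- 2 w^2 \<mu> - w^3\<close>; the resulting
  constant \<open>6 + 5/2 + 1/4\<close> is rounded up to \<open>10\<close>.\<close>

lemma cmod_quadratic_inner:
  fixes w :: real
  assumes w: "0 < w" "w \<le> 1/4" and "cmod \<mu> \<le> sqrt (1 + 4 * w^2)"
  shows "cmod (of_real (w - w^3) + of_real (1 - 2 * w^2) * \<mu> + of_real (- w) * \<mu>^2) \<le> 1 + 10 * w^2"
proof -
  have w2: "w^2 \<le> 1/16" using w power_mono[of w "1/4" 2] by (simp add: power2_eq_square)
  have m: "(cmod \<mu>)^2 \<le> 1 + 4 * w^2"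
    using assms(3) power_mono[of "cmod \<mu>" "sqrt (1 + 4 * w^2)" 2] by simp
  then have "(cmod \<mu>)^2 \<le> (5/4)^2" using w2 by (simp add: power2_eq_square)
  then have m54: "cmod \<mu> \<le> 5/4" by (rule power2_le_imp_le) simp
  have "(cmod (\<mu> + of_real w * (1 - \<mu>^2)))^2 \<le> 1 + 12 * w^2" by (rule cmod_quadratic_disc(1)[OF w m])
  also have "\<dots> \<le> (1 + 6 * w^2)^2" using w by (simp add: power2_eq_square algebra_simps)
  finally have 1: "cmod (\<mu> + of_real w * (1 - \<mu>^2)) \<le> 1 + 6 * w^2"
    by (rule power2_le_imp_le) simp
  have 2: "cmod (of_real (- 2 * w^2) * \<mu>) \<le> 2 * w^2 * (5/4)"
    using mult_left_mono[OF m54, of "2 * w^2"] unfolding norm_mult norm_of_real by simp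
  have "w^2 * w \<le> w^2 * (1/4)" using w by (intro mult_left_mono) auto
  then have 3: "cmod (of_real (- (w^3))) \<le> w^2 / 4"
    unfolding norm_of_real using w by (simp add: power2_eq_square power3_eq_cube)
  have "of_real (w - w^3) + of_real (1 - 2 * w^2) * \<mu> + of_real (- w) * \<mu>^2 =
      (\<mu> + of_real w * (1 - \<mu>^2)) + of_real (- 2 * w^2) * \<mu> + of_real (- (w^3))"
    by (simp add: algebra_simps)
  then have "cmod (of_real (w - w^3) + of_real (1 - 2 * w^2) * \<mu> + of_real (- w) * \<mu>^2) \<le>
      (1 + 6 * w^2) + 2 * w^2 * (5/4) + w^2 / 4"
    using norm_triangle_le[OF add_mono[OF norm_triangle_le[OF add_mono[OF 1 2]] 3]] by (simp only:)
  also have "\<dots> \<le> 1 + 10 * w^2" by simp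
  finally show ?thesis .
qed

text \<open>If the spectrum of \<open>a\<close> were empty, then so would be that of \<open>c 1 + a\<close> for every \<open>c\<close>, and the
  spectral radius of \<open>c 1 + T a\<close> would always be the junk value \<open>Sup {}\<close>.\<close>
lemma alg_spectrum_nonempty_transfer:
  fixes T :: "'a::complex_banach_algebra_1 \<Rightarrow> 'b::complex_banach_algebra_1"
  assumes ne: "\<And>y::'b. alg_spectrum y \<noteq> {}"
    and add: "\<And>x y. T (x + y) = T x + T y" and scale: "\<And>c x. T (c *\<^sub>C x) = c *\<^sub>C T x"
    and one: "T 1 = 1"
    and radius: "\<And>x. alg_spectral_radius (T x) = alg_spectral_radius x"
  shows "alg_spectrum (a::'a) \<noteq> {}"
proof
  assume a: "alg_spectrum a = {}"
  define K where "K = (SUP z\<in>({}::complex set). cmod z)"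
  \<comment> \<open>The shift moves the whole spectrum of \<open>T a\<close> to moduli of at least
    \<open>\<bar>K\<bar> + 1\<close>.\<close>
  define c where "c = complex_of_real (\<bar>K\<bar> + norm (T a) + 1)"
  have "alg_spectrum (c *\<^sub>C 1 + 1 *\<^sub>C a) = {}"
    using alg_spectrum_affine[of _ c 1 a] a by fastforce
  then have "alg_spectral_radius (c *\<^sub>C 1 + a) = K"
    by (simp add: alg_spectral_radius_def K_def)
  then have K: "alg_spectral_radius (c *\<^sub>C 1 + T a) = K"
    using radius[of "c *\<^sub>C 1 + a"] by (simp add: add scale one)
  obtain z where z: "z \<in> alg_spectrum (c *\<^sub>C 1 + 1 *\<^sub>C T a)" using ne by blast
  then obtain \<mu> where \<mu>: "\<mu> \<in> alg_spectrum (T a)" "z = c + \<mu>"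
    using alg_spectrum_affine[of z c 1 "T a"] by auto
  have "cmod c - cmod \<mu> \<le> cmod z" using norm_diff_ineq[of c \<mu>] \<mu>(2) by simp
  moreover have "cmod z \<le> K" using alg_spectrum_le_radius[OF z] K by simp
  moreover have "cmod \<mu> \<le> norm (T a)" by (rule norm_alg_spectrum[OF \<mu>(1)])
  moreover have "cmod c = \<bar>K\<bar> + norm (T a) + 1" unfolding c_def norm_of_real by simp
  ultimately show False by linarith
qed

text \<open>A section serves as a substitute for the inverse of a map that is not known to be injective.\<close>
lemma linear_section_through_point:
  fixes T :: "'a::complex_vector \<Rightarrow> 'b::complex_vector"
  assumes add: "\<And>x y. T (x + y) = T x + T y" and scale: "\<And>c x. T (c *\<^sub>C x) = c *\<^sub>C T x"
    and surj: "surj T" and a: "T a \<noteq> 0"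
  obtains S where "\<And>x y. S (x + y) = S x + S y" "\<And>c x. S (c *\<^sub>C x) = c *\<^sub>C S x"
    "\<And>y. T (S y) = y" "S (T a) = a"
proof -
  interpret p: vector_space_pair "scaleC :: complex \<Rightarrow> 'b \<Rightarrow> 'b" "scaleC :: complex \<Rightarrow> 'a \<Rightarrow> 'a" ..
  \<comment> \<open>The value at \<open>T a\<close> is prescribed so that the section passes through
    \<open>a\<close>; elsewhere any preimage serves.\<close>
  define f where "f y = (if y = T a then a else SOME x. T x = y)" for y
  have Tf: "T (f y) = y" for y
    unfolding f_def using surj by (auto intro: someI_ex simp: surj_def) (metis (mono_tags) someI_ex)
  have ind: "complex_vector.independent {T a}" using a by simp
  define Bs where "Bs = complex_vector.extend_basis {T a}"
  have Bs: "{T a} \<subseteq> Bs" "complex_vector.independent Bs" "complex_vector.span Bs = UNIV"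
    unfolding Bs_def using complex_vector.extend_basis_superset[OF ind]
      complex_vector.independent_extend_basis[OF ind] complex_vector.span_extend_basis[OF ind] by auto
  obtain S where S: "Vector_Spaces.linear scaleC scaleC S" "\<And>y. y \<in> Bs \<Longrightarrow> S y = f y"
    using p.linear_independent_extend[OF Bs(2)] by blast
  have S_add: "S (x + y) = S x + S y" and S_scale: "S (c *\<^sub>C x) = c *\<^sub>C S x" for x y c
    using S(1) by (simp_all add: p.linear_add p.linear_scale)
  have T0: "T 0 = 0" "S 0 = 0" using scale[of 0 0] S_scale[of 0 0] by simp_all
  have "complex_vector.subspace {y. T (S y) = y}"
    by (simp add: complex_vector.subspace_def S_add S_scale add scale T0)
  moreover have "Bs \<subseteq> {y. T (S y) = y}" using S(2) Tf by auto
  ultimately have "complex_vector.span Bs \<subseteq> {y. T (S y) = y}"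
    by (intro complex_vector.span_minimal)
  then have "T (S y) = y" for y using Bs(3) by auto
  moreover have "S (T a) = a" using S(2)[of "T a"] Bs(1) by (simp add: f_def)
  ultimately show thesis using that S_add S_scale by blast
qed

section \<open>Cartan's iteration for a spectral isometry\<close>

locale spectral_isometry =
  fixes T :: "'a::complex_banach_algebra_1 \<Rightarrow> 'b::complex_banach_algebra_1"
  assumes add: "T (x + y) = T x + T y"
    and scale: "T (c *\<^sub>C x) = c *\<^sub>C T x"
    and one: "T 1 = 1"
    and surj: "surj T"
    and radius: "alg_spectral_radius (T x) = alg_spectral_radius x"
    and spectrum_nonempty: "alg_spectrum (x :: 'a) \<noteq> {}" "alg_spectrum (u :: 'b) \<noteq> {}"
begin

lemma T_minus: "T (x - y) = T x - T y"
  using add[of "x - y" y] by (simp add: algebra_simps)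

text \<open>Up to the factor \<open>r\<close> and terms of higher order in \<open>w\<close>, this is \<open>\<psi> \<circ> T \<circ> \<psi>\<^sup>-\<^sup>1 \<circ> S\<close> for a Moebius
  transformation \<open>\<psi>\<close> of the disc: \<open>a + w a\<^sup>2\<close> maps the unit disc almost into the unit disc with
  centre \<open>w\<close>, and \<open>b - w b\<^sup>2\<close> maps that disc almost into the unit disc.\<close>
definition moebius_step :: "('b \<Rightarrow> 'a) \<Rightarrow> real \<Rightarrow> 'b \<Rightarrow> 'b" where
  "moebius_step S w y =
    (let b = T (S y + of_real w *\<^sub>C (S y * S y))
     in of_real (inverse (1 + 10 * w^2)) *\<^sub>C (b + of_real (- w) *\<^sub>C (b * b)))"

lemma moebius_step_radius:
  assumes w: "0 < w" "w \<le> 1/4" and TS: "\<And>y. T (S y) = y" and y: "alg_spectral_radius y \<le> 1"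
  shows "alg_spectral_radius (moebius_step S w y) \<le> 1"
proof -
  define a where "a = S y"
  have a: "alg_spectral_radius a \<le> 1" using radius[of a] y TS by (simp add: a_def)
  \<comment> \<open>Since \<open>T 1 = 1\<close>, this is \<open>b\<close> recentred at
    \<open>w\<close>. Its argument is estimated in the domain algebra, and \<open>radius\<close>
    carries the bound across \<open>T\<close>.\<close>
  define u where "u = T ((- of_real w) *\<^sub>C 1 + 1 *\<^sub>C a + of_real w *\<^sub>C (a * a))"
  have "alg_spectral_radius ((- of_real w) *\<^sub>C 1 + 1 *\<^sub>C a + of_real w *\<^sub>C (a * a)) \<le> sqrt (1 + 4 * w^2)"
    using w by (intro alg_spectral_radius_quadratic_le[OF spectrum_nonempty(1) _ a] cmod_quadratic_outer) auto
  then have u: "alg_spectral_radius u \<le> sqrt (1 + 4 * w^2)" unfolding u_def radius .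
  define b where "b = T (a + of_real w *\<^sub>C (a * a))"
  have b: "b = of_real w *\<^sub>C 1 + u"
    by (simp add: b_def u_def add T_minus scale one complex_vector.scale_minus_left scaleC_one)
  have w2: "(2 * of_real w) *\<^sub>C u = of_real w *\<^sub>C u + of_real w *\<^sub>C u"
    by (simp only: mult_2 scaleC_add_left)
  have "b * b = (of_real w * of_real w) *\<^sub>C 1 + (2 * of_real w) *\<^sub>C u + u * u"
    by (simp only: w2 b distrib_left distrib_right mult_scaleC_left mult_scaleC_right scaleC_scaleC
        scaleC_add_right mult_1_left mult_1_right add.assoc)
  \<comment> \<open>Inserting \<open>b = w + u\<close> produces exactly the polynomial of
    \<open>cmod_quadratic_inner\<close>.\<close>
  then have "b + of_real (- w) *\<^sub>C (b * b) = (of_real w *\<^sub>C 1 + u) +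
      of_real (- w) *\<^sub>C ((of_real w * of_real w) *\<^sub>C 1 + (2 * of_real w) *\<^sub>C u + u * u)"
    using b by simp
  also have "\<dots> = (of_real w + of_real (- w) * (of_real w * of_real w)) *\<^sub>C 1 +
      (1 + of_real (- w) * (2 * of_real w)) *\<^sub>C u + of_real (- w) *\<^sub>C (u * u)"
    by (simp only: scaleC_add_left scaleC_add_right scaleC_scaleC scaleC_one add_ac)
  also have "of_real w + of_real (- w) * (of_real w * of_real w) = complex_of_real (w - w^3)"
    by (simp add: power3_eq_cube)
  also have "1 + of_real (- w) * (2 * of_real w) = complex_of_real (1 - 2 * w^2)"
    by (simp add: power2_eq_square)
  finally have q: "alg_spectral_radius (b + of_real (- w) *\<^sub>C (b * b)) \<le> 1 + 10 * w^2"
    using alg_spectral_radius_quadratic_le[OF spectrum_nonempty(2) _ u cmod_quadratic_inner[OF w]] w by simp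
  have k: "0 < 1 + 10 * w^2" by (simp add: add_pos_nonneg)
  have "alg_spectral_radius (moebius_step S w y) \<le>
      inverse (1 + 10 * w^2) * alg_spectral_radius (b + of_real (- w) *\<^sub>C (b * b))"
    using alg_spectral_radius_scaleC_le[OF spectrum_nonempty(2), of "of_real (inverse (1 + 10 * w^2))"] k
    unfolding moebius_step_def Let_def a_def[symmetric] b_def[symmetric] norm_of_real by simp
  also have "\<dots> \<le> inverse (1 + 10 * w^2) * (1 + 10 * w^2)"
    using q k by (intro mult_left_mono) auto
  also have "\<dots> = 1" using k by simp
  finally show ?thesis .
qed

text \<open>As \<open>T\<close> undoes \<open>S\<close>, the linear part is only rescaled. The
  squares taken before and after \<open>T\<close> add \<open>w c^2 T (S x * S x)\<close> and
  \<open>- w c^2 x * x\<close> to the quadratic part, that is, \<open>w c^2\<close> times the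
  defect.\<close>

lemma germ2_moebius_step:
  assumes S: "\<And>x y. S (x + y) = S x + S y" "\<And>c x. S (c *\<^sub>C x) = c *\<^sub>C S x" "\<And>y. T (S y) = y"
    and f: "germ2 f (c *\<^sub>C x) (e *\<^sub>C (T (S x * S x) - x * x))"
  shows "germ2 (\<lambda>z. moebius_step S w (f z)) ((of_real (inverse (1 + 10 * w^2)) * c) *\<^sub>C x)
    ((of_real (inverse (1 + 10 * w^2)) * (e + of_real w * c^2)) *\<^sub>C (T (S x * S x) - x * x))"
proof -
  define d where "d = T (S x * S x) - x * x"
  note f1 = germ2_linear[of S, OF S(1,2) f]
  note f2 = germ2_linear[of T, OF add scale
      germ2_add[OF f1 germ2_scaleC[OF germ2_square[OF f1], of "of_real w"]]]
  note f3 = germ2_scaleC[OF germ2_add[OF f2 germ2_scaleC[OF germ2_square[OF f2], of "of_real (- w)"]],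
      of "of_real (inverse (1 + 10 * w^2))"]
  have "T (S (c *\<^sub>C x) + of_real w *\<^sub>C 0) + of_real (- w) *\<^sub>C 0 = c *\<^sub>C x"
    by (simp add: S(3))
  moreover have "T (S (e *\<^sub>C d) + of_real w *\<^sub>C (S (c *\<^sub>C x) * S (c *\<^sub>C x))) +
      of_real (- w) *\<^sub>C (T (S (c *\<^sub>C x) + of_real w *\<^sub>C 0) * T (S (c *\<^sub>C x) + of_real w *\<^sub>C 0)) =
      (e + of_real w * c^2) *\<^sub>C d"
    by (simp add: add scale S mult_scaleC_left mult_scaleC_right scaleC_scaleC scaleC_add_left
        d_def complex_vector.scale_right_diff_distrib complex_vector.scale_minus_left power2_eq_square)
  ultimately show ?thesis
    using f3 by (simp add: moebius_step_def Let_def d_def[symmetric] scaleC_scaleC)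
qed

text \<open>Each step adds \<open>w\<close> times the squared linear factor to the quadratic
  coefficient and then scales by \<open>r\<close>. The lower bound for \<open>e\<close> counts
  \<open>k\<close> contributions of \<open>w\<close>, each damped by no more than
  \<open>r ^ (2 * k)\<close>.\<close>

lemma moebius_iterates:
  assumes S: "\<And>x y. S (x + y) = S x + S y" "\<And>c x. S (c *\<^sub>C x) = c *\<^sub>C S x" "\<And>y. T (S y) = y"
    and w: "0 < w" "w \<le> 1/4" and x: "alg_spectral_radius x \<le> 1"
    and r_def: "r = inverse (1 + 10 * w^2)"
  shows "\<exists>f e. (\<forall>z. cmod z = 1 \<longrightarrow> alg_spectral_radius (f z) \<le> 1) \<and> real k * r ^ (2 * k) * w \<le> e \<and>
    germ2 f (of_real (r ^ k) *\<^sub>C x) (of_real e *\<^sub>C (T (S x * S x) - x * x))"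
proof (induction k)
  case 0
  have "alg_spectral_radius (z *\<^sub>C x) \<le> 1" if "cmod z = 1" for z
    using alg_spectral_radius_scaleC_le[OF spectrum_nonempty(2), of z x] that x by simp
  then show ?case
    using germ2_identity[of x] by (intro exI[of _ "\<lambda>z. z *\<^sub>C x"] exI[of _ 0]) (simp add: scaleC_one)
next
  case (Suc k)
  then obtain f e where f: "\<And>z. cmod z = 1 \<Longrightarrow> alg_spectral_radius (f z) \<le> 1"
    "real k * r ^ (2 * k) * w \<le> e"
    "germ2 f (of_real (r ^ k) *\<^sub>C x) (of_real e *\<^sub>C (T (S x * S x) - x * x))" by blast
  define e' where "e' = r * (e + w * (r ^ k)^2)"
  have r: "0 < r" "r \<le> 1" unfolding r_def by (simp_all add: add_pos_nonneg inverse_le_1_iff)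
  have "real (Suc k) * r ^ (2 * Suc k) * w = r * (r * (real k * r ^ (2 * k) * w + w * r ^ (2 * k)))"
    by (simp add: algebra_simps power2_eq_square)
  also have "\<dots> \<le> r * (1 * (real k * r ^ (2 * k) * w + w * r ^ (2 * k)))"
    using r w by (intro mult_left_mono mult_right_mono) auto
  also have "\<dots> \<le> e'"
    unfolding e'_def using r f(2) by (intro mult_left_mono) (auto simp: power_mult[symmetric] mult.commute)
  finally have e': "real (Suc k) * r ^ (2 * Suc k) * w \<le> e'" .
  have germ: "germ2 (\<lambda>z. moebius_step S w (f z)) (of_real (r ^ Suc k) *\<^sub>C x)
      (of_real e' *\<^sub>C (T (S x * S x) - x * x))"
    using germ2_moebius_step[OF S f(3), of w] by (simp add: e'_def r_def[symmetric])
  have "\<forall>z. cmod z = 1 \<longrightarrow> alg_spectral_radius (moebius_step S w (f z)) \<le> 1"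
    using moebius_step_radius[OF w S(3) f(1)] by simp
  from conjI[OF this conjI[OF e' germ]] show ?case
    by (intro exI[of _ "\<lambda>z. moebius_step S w (f z)"] exI[of _ e'])
qed

end

text \<open>Take \<open>w = 1 / m\<close> and \<open>k = m^2\<close>: then \<open>k w = m\<close> is
  unbounded, while the damping factor stays above \<open>exp (- 30)\<close>.\<close>

lemma iterate_bound_imp_zero:
  fixes A N :: real
  assumes A: "0 \<le> A"
    and bnd: "\<And>w k. 0 < w \<Longrightarrow> w \<le> 1/4 \<Longrightarrow> real k * inverse (1 + 10 * w^2) ^ (3 * k) * w * A \<le> N"
  shows "A = 0"
proof -
  have "real m * (exp (- 30) * A) \<le> N" if m: "m \<ge> 4" for m :: nat
  proof -
    define w where "w = 1 / real m"
    have w: "0 < w" "w \<le> 1/4" using m by (auto simp: w_def field_simps)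
    have "(1 + 10 * w^2) ^ (3 * m^2) \<le> exp (10 * w^2) ^ (3 * m^2)"
      by (intro power_mono exp_ge_add_one_self) (simp add: add_nonneg_nonneg)
    also have "\<dots> = exp 30"
      using m by (simp add: exp_of_nat_mult[symmetric] w_def field_simps)
    finally have "inverse (exp 30) \<le> inverse ((1 + 10 * w^2) ^ (3 * m^2))"
      by (intro le_imp_inverse_le) (simp_all add: add_pos_nonneg)
    then have "exp (- 30) \<le> inverse (1 + 10 * w^2) ^ (3 * m^2)"
      by (simp add: exp_minus power_inverse)
    then have "(real (m^2) * w * A) * exp (- 30) \<le> (real (m^2) * w * A) * inverse (1 + 10 * w^2) ^ (3 * m^2)"
      using A w by (intro mult_left_mono) auto
    also have "\<dots> \<le> N" using bnd[OF w, of "m^2"] by (simp add: ac_simps)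
    finally show ?thesis using m by (simp add: w_def power2_eq_square ac_simps)
  qed
  then have "exp (- 30) * A \<le> 0" by (rule zero_if_multiples_bounded)
  then show ?thesis using A by (simp add: mult_le_0_iff)
qed

section \<open>Trace identities for the Jordan defect\<close>

locale spectral_isometry_trace = spectral_isometry T
  for T :: "'a::complex_banach_algebra_1 \<Rightarrow> 'b::complex_banach_algebra_1" +
  fixes t :: "'b \<Rightarrow> complex" and N :: real
  assumes t_add: "t (x + y) = t x + t y"
    and t_scale: "t (c *\<^sub>C x) = c * t x"
    and t_commute: "t (x * y) = t (y * x)"
    and N_nonneg: "0 \<le> N"
    and t_bound: "cmod (t x) \<le> N * alg_spectral_radius x"
begin

lemma t_minus: "t (x - y) = t x - t y"
  using t_add[of "x - y" y] by (simp add: algebra_simps)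

lemma t_bound_1: "alg_spectral_radius x \<le> 1 \<Longrightarrow> cmod (t x) \<le> N"
  using t_bound[of x] N_nonneg mult_left_mono[of "alg_spectral_radius x" 1 N] by simp

text \<open>The quadratic coefficient of the iterates bounds \<open>e\<close> times
  \<open>t d\<close>; the cubic coefficient of their squares bounds \<open>r ^ k * e\<close> times
  \<open>t (x * d)\<close>. The additional \<open>r ^ k\<close> stems from the linear part, hence
  the exponent \<open>3 * k\<close>.\<close>

lemma trace_defect_zero_aux:
  assumes a: "T a \<noteq> 0" and ra: "alg_spectral_radius a \<le> 1"
  shows "t (T (a * a) - T a * T a) = 0" "t (T a * (T (a * a) - T a * T a)) = 0"
proof -
  obtain S where S: "\<And>x y. S (x + y) = S x + S y" "\<And>c x. S (c *\<^sub>C x) = c *\<^sub>C S x"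
    "\<And>y. T (S y) = y" "S (T a) = a"
    using linear_section_through_point[of T, OF add scale surj a] by metis
  define x d where "x = T a" and "d = T (a * a) - T a * T a"
  have x: "alg_spectral_radius x \<le> 1" using ra by (simp add: x_def radius)
  have *: "real k * r ^ (3 * k) * w * cmod (t d) \<le> N \<and> real k * r ^ (3 * k) * w * cmod (t (x * d)) \<le> N"
    if w: "0 < w" "w \<le> 1/4" and r_def: "r = inverse (1 + 10 * w^2)" for w r k
  proof -
    obtain f e where f: "\<And>z. cmod z = 1 \<Longrightarrow> alg_spectral_radius (f z) \<le> 1"
      and e: "real k * r ^ (2 * k) * w \<le> e"
      and germ: "germ2 f (of_real (r ^ k) *\<^sub>C x) (of_real e *\<^sub>C d)"
      \<comment> \<open>As \<open>S (T a) = a\<close>, the defect produced by the iteration is that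
        of \<open>a\<close>.\<close>
      using moebius_iterates[OF S(1-3) w x r_def, of k] S(4)[folded x_def]
      by (auto simp: d_def x_def[symmetric])
    have r: "0 < r" "r \<le> 1" unfolding r_def by (simp_all add: add_pos_nonneg inverse_le_1_iff)
    have e0: "0 \<le> e" using r w by (intro order_trans[OF _ e]) auto
    have "real k * r ^ (3 * k) * w = r ^ k * (real k * r ^ (2 * k) * w)"
      by (simp add: power_add[symmetric] flip: mult_2)
    also have "\<dots> \<le> r ^ k * e" using e r by (intro mult_left_mono) auto
    finally have e3: "real k * r ^ (3 * k) * w \<le> r ^ k * e" .
    also have "\<dots> \<le> 1 * e" using r e0 by (intro mult_right_mono power_le_one) auto
    finally have e2: "real k * r ^ (3 * k) * w \<le> e" by simp
    obtain g where g: "vpoly g"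
      "f = (\<lambda>z. z *\<^sub>C (of_real (r ^ k) *\<^sub>C x + z *\<^sub>C (of_real e *\<^sub>C d + z *\<^sub>C g z)))"
      using germ unfolding germ2_def by blast
    have "cmod (t ([0, of_real (r ^ k) *\<^sub>C x, of_real e *\<^sub>C d] ! 2)) * 1 ^ 2 \<le> N"
    proof (rule vpoly_coeff_bound[OF t_add t_scale g(1)])
      fix z assume "cmod z = 1"
      from t_bound_1[OF f[OF this]]
      show "cmod (t (foldr (\<lambda>a w. a + z *\<^sub>C w) [0, of_real (r ^ k) *\<^sub>C x, of_real e *\<^sub>C d] (g z))) \<le> N"
        by (simp add: g(2))
    qed auto
    then have 1: "e * cmod (t d) \<le> N" using e0 by (simp add: t_scale norm_mult)
    obtain h where h: "vpoly h" "\<And>z. f z * f z = 0 + z *\<^sub>C (0 + z *\<^sub>C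
        ((of_real (r ^ k) *\<^sub>C x) * (of_real (r ^ k) *\<^sub>C x) + z *\<^sub>C (((of_real (r ^ k) *\<^sub>C x) * (of_real e *\<^sub>C d) +
          (of_real e *\<^sub>C d) * (of_real (r ^ k) *\<^sub>C x)) + z *\<^sub>C h z)))"
      using germ2_square_expansion[OF germ] by blast
    have "cmod (t ([0, 0, (of_real (r ^ k) *\<^sub>C x) * (of_real (r ^ k) *\<^sub>C x),
        (of_real (r ^ k) *\<^sub>C x) * (of_real e *\<^sub>C d) + (of_real e *\<^sub>C d) * (of_real (r ^ k) *\<^sub>C x)] ! 3)) * 1 ^ 3 \<le> N"
    proof (rule vpoly_coeff_bound[OF t_add t_scale h(1)])
      fix z assume z: "cmod z = 1"
      have "alg_spectral_radius (f z * f z) \<le> (alg_spectral_radius (f z))^2"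
        by (rule alg_spectral_radius_square_le[OF spectrum_nonempty(2)])
      also have "\<dots> \<le> 1"
        using f[OF z] alg_spectral_radius_nonneg[OF spectrum_nonempty(2)] by (intro power_le_one)
      finally have "cmod (t (f z * f z)) \<le> N" by (rule t_bound_1)
      then show "cmod (t (foldr (\<lambda>a w. a + z *\<^sub>C w)
          [0, 0, (of_real (r ^ k) *\<^sub>C x) * (of_real (r ^ k) *\<^sub>C x),
          (of_real (r ^ k) *\<^sub>C x) * (of_real e *\<^sub>C d) + (of_real e *\<^sub>C d) * (of_real (r ^ k) *\<^sub>C x)] (h z))) \<le> N"
        unfolding h(2) by simp
    qed auto
    then have "cmod (of_real (2 * (r ^ k * e)) * t (x * d)) \<le> N"
      using t_commute[of d x]
      by (simp add: t_scale t_add mult_scaleC_left mult_scaleC_right scaleC_scaleC ac_simps)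
    then have "2 * (r ^ k * e) * cmod (t (x * d)) \<le> N"
      unfolding norm_mult norm_of_real using e0 r by simp
    moreover have "0 \<le> r ^ k * e * cmod (t (x * d))" using e0 r by simp
    ultimately have 2: "r ^ k * e * cmod (t (x * d)) \<le> N" by linarith
    show ?thesis
      using order_trans[OF mult_right_mono[OF e2] 1] order_trans[OF mult_right_mono[OF e3] 2] by simp
  qed
  have "cmod (t d) = 0"
    by (rule iterate_bound_imp_zero[of _ N]) (use *[OF _ _ refl] in auto)
  moreover have "cmod (t (x * d)) = 0"
    by (rule iterate_bound_imp_zero[of _ N]) (use *[OF _ _ refl] in auto)
  ultimately show "t (T (a * a) - T a * T a) = 0" "t (T a * (T (a * a) - T a * T a)) = 0"
    by (simp_all add: x_def d_def)
qed

lemma trace_defect_zero: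
  shows "t (T (a * a) - T a * T a) = 0" and "t (T a * (T (a * a) - T a * T a)) = 0"
proof -
  have *: "t (T (a * a) - T a * T a) = 0 \<and> t (T a * (T (a * a) - T a * T a)) = 0"
    if a: "T a \<noteq> 0" for a
  proof -
    \<comment> \<open>The defect is homogeneous of degree two, so \<open>a\<close> may be scaled
      into the spectral unit ball; adding \<open>1\<close> avoids division by zero.\<close>
    define s where "s = complex_of_real (inverse (1 + alg_spectral_radius a))"
    have nn: "0 \<le> alg_spectral_radius a" by (rule alg_spectral_radius_nonneg[OF spectrum_nonempty(1)])
    then have s0: "s \<noteq> 0" unfolding s_def of_real_eq_0_iff by simp
    have "alg_spectral_radius (s *\<^sub>C a) \<le> cmod s * alg_spectral_radius a"
      by (rule alg_spectral_radius_scaleC_le[OF spectrum_nonempty(1)])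
    also have "cmod s = inverse (1 + alg_spectral_radius a)"
      unfolding s_def norm_of_real using nn by simp
    also have "inverse (1 + alg_spectral_radius a) * alg_spectral_radius a \<le> 1"
      using nn by (simp add: field_simps)
    finally have "alg_spectral_radius (s *\<^sub>C a) \<le> 1" .
    moreover have "T (s *\<^sub>C a) \<noteq> 0" using a s0 by (simp add: scale)
    ultimately have "t (T ((s *\<^sub>C a) * (s *\<^sub>C a)) - T (s *\<^sub>C a) * T (s *\<^sub>C a)) = 0"
      "t (T (s *\<^sub>C a) * (T ((s *\<^sub>C a) * (s *\<^sub>C a)) - T (s *\<^sub>C a) * T (s *\<^sub>C a))) = 0"
      using trace_defect_zero_aux by blast+
    moreover have "T ((s *\<^sub>C a) * (s *\<^sub>C a)) - T (s *\<^sub>C a) * T (s *\<^sub>C a) = (s * s) *\<^sub>C (T (a * a) - T a * T a)"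
      by (simp add: scaleC_mult_scaleC scale complex_vector.scale_right_diff_distrib)
    ultimately show ?thesis using s0 by (simp add: scale t_scale scaleC_mult_scaleC)
  qed
  show "t (T (a * a) - T a * T a) = 0"
  proof (cases "T a = 0")
    case True
    \<comment> \<open>Adding \<open>1\<close> leaves the defect unchanged and makes the image
      nonzero.\<close>
    then have "T (a + 1) \<noteq> 0" by (simp add: add one)
    from conjunct1[OF *[OF this]] show ?thesis
      by (simp add: True add one distrib_left distrib_right)
  qed (use * in blast)
  show "t (T a * (T (a * a) - T a * T a)) = 0"
  proof (cases "T a = 0")
    case True
    then show ?thesis using t_scale[of 0 0] by simp
  qed (use * in blast)
qed

text \<open>Since \<open>T\<close> is not known to be multiplicative, this does not follow from
  \<open>t_commute\<close>. The commutator lemma is applied in the domain algebra to the composite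
  of \<open>t\<close> and \<open>T\<close>, which obeys the same spectral bound.\<close>

lemma trace_commute: "t (T (a * b)) = t (T (b * a))"
proof (rule bounded_functional_commutator[OF spectrum_nonempty(1)])
  show "cmod (t (T x)) \<le> N * alg_spectral_radius x" for x
    using t_bound[of "T x"] by (simp add: radius)
qed (simp_all add: add scale t_add t_scale N_nonneg)

text \<open>Polarisation gives only the symmetrised identity; the two trace symmetries merge its
  mixed terms.\<close>

lemma trace_mult: "t (T (a * b)) = t (T a * T b)"
proof -
  have sq: "t (T (a * a)) = t (T a * T a)" for a
    using trace_defect_zero(1)[of a] by (simp add: t_minus)
  have "t (T (a * b)) + t (T (b * a)) = t (T a * T b) + t (T b * T a)"
    using sq[of "a + b"] sq[of a] sq[of b]
    by (simp add: add t_add distrib_left distrib_right add_ac)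
  then show ?thesis using trace_commute[of b a] t_commute[of "T b" "T a"] by simp
qed

lemma trace_cube: "t (T (a * a * a)) = t (T a * T a * T a)"
proof -
  have "t (T a * T (a * a)) = t (T a * (T a * T a))"
    using trace_defect_zero(2)[of a] by (simp add: right_diff_distrib t_minus)
  then show ?thesis using trace_mult[of a "a * a"] by (simp add: mult.assoc)
qed

text \<open>Expanding the cubic identity at \<open>a + c\<close> and \<open>a - c\<close> leaves, up
  to cyclic order, only the terms \<open>c a a\<close> and \<open>c c a\<close>. The two expansions
  together separate them.\<close>

lemma trace_annihilates_defect: "t (T c * (T (a * a) - T a * T a)) = 0"
proof -
  have A: "t (T (a * c * a)) = t (T (c * a * a))" "t (T (a * a * c)) = t (T (c * a * a))"
    using trace_commute[of a "c * a"] trace_commute[of "a * a" c] by (simp_all add: mult.assoc)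
  have B: "t (T a * T c * T a) = t (T c * T a * T a)" "t (T a * T a * T c) = t (T c * T a * T a)"
    using t_commute[of "T a" "T c * T a"] t_commute[of "T a * T a" "T c"] by (simp_all add: mult.assoc)
  have C: "t (T (a * c * c)) = t (T (c * c * a))" "t (T (c * a * c)) = t (T (c * c * a))"
    using trace_commute[of a "c * c"] trace_commute[of "c * a" c] by (simp_all add: mult.assoc)
  have D: "t (T a * T c * T c) = t (T c * T c * T a)" "t (T c * T a * T c) = t (T c * T c * T a)"
    using t_commute[of "T a" "T c * T c"] t_commute[of "T c * T a" "T c"] by (simp_all add: mult.assoc)
  have "3 * t (T (c * a * a)) + 3 * t (T (c * c * a)) = 3 * t (T c * T a * T a) + 3 * t (T c * T c * T a)"
    using trace_cube[of "a + c"] trace_cube[of a] trace_cube[of c] A B C D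
    by (simp add: add t_add distrib_left distrib_right add_ac)
  moreover have "3 * t (T (c * c * a)) - 3 * t (T (c * a * a)) = 3 * t (T c * T c * T a) - 3 * t (T c * T a * T a)"
    using trace_cube[of "a - c"] trace_cube[of a] trace_cube[of c] A B C D
    by (simp add: T_minus t_minus left_diff_distrib right_diff_distrib)
  moreover have "p = P" if "3 * p + 3 * q = 3 * P + 3 * Q" "3 * q - 3 * p = 3 * Q - 3 * P"
    for p q P Q :: complex
  proof -
    have "6 * p = (3 * p + 3 * q) - (3 * q - 3 * p)" by simp
    also have "\<dots> = 6 * P" unfolding that by simp
    finally show ?thesis by simp
  qed
  ultimately have "t (T (c * a * a)) = t (T c * T a * T a)" by blast
  then show ?thesis
    using trace_mult[of c "a * a"] by (simp add: right_diff_distrib t_minus mult.assoc)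
qed

end

theorem theorem2:
  fixes T :: "'a::complex_banach_algebra_1 \<Rightarrow> 'b::complex_banach_algebra_1"
  assumes semisimple: "(jacobson_radical :: 'a set) = {0}"
    and separating: "separating_fd_irreducible_reps TYPE('x::complex_vector) TYPE('b)"
    and linear: "Vector_Spaces.linear scaleC scaleC T"
    and unital: "T 1 = 1"
    and surjective: "surj T"
    and spectral_radius: "\<forall>a. alg_spectral_radius (T a) = alg_spectral_radius a"
  shows "\<forall>a. T (a ^ 2) = (T a) ^ 2"
proof
  fix a
  interpret p: vector_space_pair "scaleC :: complex \<Rightarrow> 'a \<Rightarrow> 'a" "scaleC :: complex \<Rightarrow> 'b \<Rightarrow> 'b" ..
  have add: "T (x + y) = T x + T y" and scale: "T (c *\<^sub>C x) = c *\<^sub>C T x" for x y c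
    using linear by (simp_all add: p.linear_add p.linear_scale)
  define d where "d = T (a * a) - T a * T a"
  have "d = 0"
  proof (rule ccontr)
    assume "d \<noteq> 0"
    then obtain X :: "'x set" and \<pi> :: "'b \<Rightarrow> 'x \<Rightarrow> 'x" where
      irr: "fd_irreducible_rep X \<pi>" and nz: "nonzero_on X (\<pi> d)"
      using separating unfolding separating_fd_irreducible_reps_def by blast
    obtain t N where t: "\<And>a b. t (a + b) = t a + t b" "\<And>c b. t (c *\<^sub>C b) = c * t b"
      "\<And>a b. t (a * b) = t (b * a)" "0 \<le> N" "\<And>b::'b. cmod (t b) \<le> N * alg_spectral_radius b"
      "\<And>d. nonzero_on X (\<pi> d) \<Longrightarrow> \<exists>c. t (c * d) \<noteq> 0" and ne: "\<And>b::'b. alg_spectrum b \<noteq> {}"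
      by (rule fd_irreducible_rep_trace[OF irr]) (rule that; assumption)
    \<comment> \<open>The representation yields nonempty spectra in the target; \<open>T\<close>
      transfers this to the domain.\<close>
    have "alg_spectrum x \<noteq> {}" for x :: 'a
      by (rule alg_spectrum_nonempty_transfer[of T, OF ne add scale unital]) (simp add: spectral_radius)
    then interpret spectral_isometry_trace T t N
      using add scale unital surjective spectral_radius t(1-5) ne by unfold_locales auto
    obtain c where "t (c * d) \<noteq> 0" using t(6)[OF nz] by blast
    moreover obtain c' where "c = T c'" using surjective by (metis surjD)
    ultimately show False using trace_annihilates_defect[of c' a] by (simp add: d_def)
  qed
  then show "T (a ^ 2) = (T a) ^ 2" by (simp add: d_def power2_eq_square)
qed

end
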